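(* For all $\mu_0,\mu_1\in\mathcal M$ one has $D^{a,b}_p(\mu_0,\mu_1)\le\mathcal W^{a,b}_p(\mu_0,\mu_1)$, and the inequality is strict if $\mu_0-\mu_1\notin\mathrm{span}\{p\}$.
   Context: Setting. $\mathcal X$ is a finite set, $K:\mathcal X\times\mathcal X\to[0,\infty)$ an irreducible Markov kernel ($\sum_y K(x,y)=1$) with unique invariant probability $\varpi$ ($\varpi(x)=\sum_y\varpi(y)K(y,x)$, $\sum_y\varpi(y)=1$), assumed reversible: $K(x,y)\varpi(x)=K(y,x)\varpi(y)$. $\mathcal M$ is the set of $\mu:\mathcal X\to[0,\infty)$ and $\mathcal M_+$ the set of $\mu:\mathcal X\to(0,\infty)$. Fix $a,b>0$ and $p\in\mathcal M_+$ with $\sum_x p(x)\varpi(x)=1$. For $\psi\in\mathbb R^{\mathcal X}$, $\|\psi\|_{\varpi,1}=\sum_x|\psi(x)|\varpi(x)$. Notation. $(\nabla\cdot\Psi)(x)=\frac12\sum_y(\Psi(x,y)-\Psi(y,x))K(x,y)$ for $\Psi\in\mathbb R^{\mathcal X\times\mathcal X}$. Logarithmic mean: $\theta(u,v)=\int_0^1u^\xi v^{1-\xi}\,d\xi$ for $u,v\ge0$, i.e. $\theta(u,u)=u$, $\theta(u,v)=\frac{u-v}{\log u-\log v}$ for $u\ne v$ positive, and $\theta(u,v)=0$ if $u=0$ or $v=0$. $\hat\mu(x,y)=\theta(\mu(x),\mu(y))$. Let $\alpha(v,s,t)=v^2/\theta(s,t)$ for $v\in\mathbb R$, $s,t\ge0$,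 with $v^2/0=0$ if $v=0$ and $v^2/0=+\infty$ if $v\neq0$; $A'(\mu,V)=\frac12\sum_{x,y}\alpha(V(x,y),\mu(x),\mu(y))K(x,y)\varpi(x)$ (with $0\cdot\infty=0$). Metric $\mathcal W$. $\mathcal W^{a,b}_p(\mu_0,\mu_1)\ge0$ and $\mathcal W^{a,b}_p(\mu_0,\mu_1)^2$ is the infimum of $a^2\int_0^1h_t^2\,dt+b^2\int_0^1\frac12\sum_{x,y}(\psi_t(y)-\psi_t(x))^2\hat\mu_t(x,y)K(x,y)\varpi(x)\,dt$ over all triples $(\mu_t,\psi_t,h_t)_{t\in[0,1]}$ with $t\mapsto\mu_t\in\mathcal M$ absolutely continuous on $[0,1]$ with the given endpoints $\mu_0,\mu_1$, $\psi:[0,1]\to\mathbb R^{\mathcal X}$ and $h:[0,1]\to\mathbb R$ measurable, and $\dot\mu_t(x)+\sum_y(\psi_t(y)-\psi_t(x))\hat\mu_t(x,y)K(x,y)=h_tp(x)$ for a.e. $t$ and all $x$. Shift--transport metric. ${\rm ST}_p(\mu_0,\mu_1;[0,1])$ is the set of quadruplets $(H_0,H_1,(\nu_t)_{t\in[0,1]},(U_t)_{t\in[0,1]})$ with $H_0,H_1\in\mathbb R$, $\mu_0+H_0p\in\mathcal M$, $\mu_1+H_1p\in\mathcal M$, $\|\mu_0\|_{\varpi,1}+H_0=\|\mu_1\|_{\varpi,1}+H_1$, $\nu:[0,1]\to\mathcal M$ absolutely continuous, $U:[0,1]\to\mathbb R^{\mathcal X\times\mathcal X}$ measurable, $\dot\nu_t+\nabla\cdot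 U_t=0$ for a.e. $t$, $\nu_0=\mu_0+H_0p$, $\nu_1=\mu_1+H_1p$. Then $$D^{a,b}_p(\mu_0,\mu_1)=\inf\Big\{\Big(a^2(|H_0|+|H_1|)^2+b^2\int_0^1A'(\nu_t,U_t)\,dt\Big)^{1/2}\Big\},$$ the infimum being over ${\rm ST}_p(\mu_0,\mu_1;[0,1])$. *)

theory Defs
  imports "HOL-Analysis.Analysis"
begin

section \<open>Reversible Markov kernels on a finite set\<close>

text \<open>The finite set is the universe of a type of class \<open>finite\<close>.  Elements of
  \<open>\<real>\<^sup>X\<close> are vectors of type \<open>real ^ 'x\<close>, and elements of \<open>\<real>\<^sup>X\<^sup>\<times>\<^sup>X\<close> are of type
  \<open>real ^ 'x ^ 'x\<close>, with \<open>\<Psi> $ x $ y\<close> standing for \<open>\<Psi>(x, y)\<close>.\<close>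

definition markov_kernel :: "('x::finite \<Rightarrow> 'x \<Rightarrow> real) \<Rightarrow> bool" where
  "markov_kernel K \<longleftrightarrow> (\<forall>x y. 0 \<le> K x y) \<and> (\<forall>x. (\<Sum>y\<in>UNIV. K x y) = 1)"

definition irreducible_kernel :: "('x::finite \<Rightarrow> 'x \<Rightarrow> real) \<Rightarrow> bool" where
  "irreducible_kernel K \<longleftrightarrow> (\<forall>x y. (x, y) \<in> {(u, v). K u v > 0}\<^sup>*)"

definition invariant_probability :: "('x::finite \<Rightarrow> 'x \<Rightarrow> real) \<Rightarrow> ('x \<Rightarrow> real) \<Rightarrow> bool" where
  "invariant_probability K \<pi> \<longleftrightarrow>
     (\<forall>x. 0 \<le> \<pi> x) \<and> (\<Sum>x\<in>UNIV. \<pi> x) = 1 \<and> (\<forall>x. \<pi> x = (\<Sum>y\<in>UNIV. \<pi> y * K y x))"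

definition reversible_kernel :: "('x::finite \<Rightarrow> 'x \<Rightarrow> real) \<Rightarrow> ('x \<Rightarrow> real) \<Rightarrow> bool" where
  "reversible_kernel K \<pi> \<longleftrightarrow> (\<forall>x y. K x y * \<pi> x = K y x * \<pi> y)"

definition meas :: "(real ^ 'x::finite) set" where
  "meas = {\<mu>. \<forall>x. 0 \<le> \<mu> $ x}"

definition pos_meas :: "(real ^ 'x::finite) set" where
  "pos_meas = {\<mu>. \<forall>x. 0 < \<mu> $ x}"

definition wnorm1 :: "('x::finite \<Rightarrow> real) \<Rightarrow> real ^ 'x \<Rightarrow> real" where
  "wnorm1 \<pi> \<psi> = (\<Sum>x\<in>UNIV. \<bar>\<psi> $ x\<bar> * \<pi> x)"

definition divg :: "('x::finite \<Rightarrow> 'x \<Rightarrow> real) \<Rightarrow> real ^ 'x ^ 'x \<Rightarrow> real ^ 'x" where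
  "divg K \<Psi> = (\<chi> x. 1 / 2 * (\<Sum>y\<in>UNIV. (\<Psi> $ x $ y - \<Psi> $ y $ x) * K x y))"


section \<open>The logarithmic mean and the action density\<close>

text \<open>The library convention \<open>0 powr \<xi> = 0\<close> (including \<open>\<xi> = 0\<close>) only affects
  one endpoint of the interval of integration.\<close>

definition log_mean :: "real \<Rightarrow> real \<Rightarrow> real" where
  "log_mean u v = integral {0..1} (\<lambda>\<xi>. u powr \<xi> * v powr (1 - \<xi>))"

lemma log_mean_same: "0 \<le> u \<Longrightarrow> log_mean u u = u"
  by (cases "u = 0") (simp_all add: log_mean_def flip: powr_add)

lemma log_mean_zero: "u = 0 \<or> v = 0 \<Longrightarrow> log_mean u v = 0"
  by (auto simp: log_mean_def)

lemma log_mean_distinct: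
  assumes "0 < u" "0 < v" "u \<noteq> v"
  shows "log_mean u v = (u - v) / (ln u - ln v)"
proof -
  define F where "F \<xi> = exp (\<xi> * ln u + (1 - \<xi>) * ln v) / (ln u - ln v)" for \<xi> :: real
  have ne: "ln u - ln v \<noteq> 0" using assms by simp
  have eq: "u powr \<xi> * v powr (1 - \<xi>) = exp (\<xi> * ln u + (1 - \<xi>) * ln v)" for \<xi>
    using assms by (simp add: powr_def exp_add)
  have "((\<lambda>\<xi>. exp (\<xi> * ln u + (1 - \<xi>) * ln v)) has_integral (F 1 - F 0)) {0..1}"
  proof (rule fundamental_theorem_of_calculus)
    fix \<xi> :: real
    have "(F has_real_derivative
        exp (\<xi> * ln u + (1 - \<xi>) * ln v) * (ln u - ln v) / (ln u - ln v)) (at \<xi> within {0..1})"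
      unfolding F_def by (intro derivative_eq_intros refl | use ne in simp)+
    then show "(F has_vector_derivative exp (\<xi> * ln u + (1 - \<xi>) * ln v)) (at \<xi> within {0..1})"
      using ne by (simp add: has_real_derivative_iff_has_vector_derivative)
  qed simp
  moreover have "F 1 - F 0 = (u - v) / (ln u - ln v)"
    using assms by (simp add: F_def diff_divide_distrib)
  ultimately show ?thesis
    by (simp add: log_mean_def eq integral_unique)
qed

text \<open>In \<open>ennreal\<close>, \<open>c / 0 = \<infinity>\<close> for \<open>c > 0\<close>, while \<open>0 / 0 = 0\<close> and \<open>0 * \<infinity> = 0\<close>,
  which are the conventions required of the action.\<close>

definition action_dens :: "real \<Rightarrow> real \<Rightarrow> real \<Rightarrow> ennreal" where
  "action_dens v s t = ennreal (v\<^sup>2) / ennreal (log_mean s t)"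

lemma action_dens_zero:
  "log_mean s t = 0 \<Longrightarrow> action_dens v s t = (if v = 0 then 0 else \<infinity>)"
  by (simp add: action_dens_def ennreal_divide_zero)

lemma action_dens_pos:
  "0 < log_mean s t \<Longrightarrow> action_dens v s t = ennreal (v\<^sup>2 / log_mean s t)"
  by (simp add: action_dens_def divide_ennreal)

definition action' ::
  "('x::finite \<Rightarrow> 'x \<Rightarrow> real) \<Rightarrow> ('x \<Rightarrow> real) \<Rightarrow> real ^ 'x \<Rightarrow> real ^ 'x ^ 'x \<Rightarrow> ennreal" where
  "action' K \<pi> \<mu> V =
     (\<Sum>x\<in>UNIV. \<Sum>y\<in>UNIV.
        action_dens (V $ x $ y) (\<mu> $ x) (\<mu> $ y) * ennreal (K x y * \<pi> x)) / 2"


section \<open>Absolutely continuous curves\<close>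

text \<open>The library's \<open>absolutely_continuous\<close> is about measures; this is the
  \<open>\<epsilon>\<close>-\<open>\<delta>\<close> notion for curves, a pair \<open>(s, t)\<close> coding the open interval from \<open>s\<close> to \<open>t\<close>.\<close>

definition abs_cont_curve :: "real \<Rightarrow> real \<Rightarrow> (real \<Rightarrow> 'a::metric_space) \<Rightarrow> bool" where
  "abs_cont_curve l r f \<longleftrightarrow>
     (\<forall>\<epsilon>>0. \<exists>\<delta>>0. \<forall>I. finite I
        \<and> (\<forall>(s, t)\<in>I. l \<le> s \<and> s < t \<and> t \<le> r)
        \<and> pairwise (\<lambda>i j. disjnt {fst i<..<snd i} {fst j<..<snd j}) I
        \<and> (\<Sum>(s, t)\<in>I. t - s) < \<delta>
        \<longrightarrow> (\<Sum>(s, t)\<in>I. dist (f s) (f t)) < \<epsilon>)"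


section \<open>The two metrics\<close>

text \<open>Costs are extended nonnegative reals, so that the infimum of an empty set of
  competitors is \<open>\<infinity>\<close> and competitors of infinite cost are harmless.\<close>

definition esqrt :: "ennreal \<Rightarrow> ennreal" where
  "esqrt c = (if c = \<infinity> then \<infinity> else ennreal (sqrt (enn2real c)))"

lemma esqrt_power2: "(esqrt c)\<^sup>2 = c"
  by (cases c) (auto simp: esqrt_def power2_eq_square simp flip: ennreal_mult)

text \<open>The curves matter only on \<open>{0..1}\<close>; derivatives are taken within that interval.\<close>

definition W_curves ::
  "('x::finite \<Rightarrow> 'x \<Rightarrow> real) \<Rightarrow> real ^ 'x \<Rightarrow> real ^ 'x \<Rightarrow> real ^ 'x \<Rightarrow>
   ((real \<Rightarrow> real ^ 'x) \<times> (real \<Rightarrow> real ^ 'x) \<times> (real \<Rightarrow> real)) set" where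
  "W_curves K p \<mu>0 \<mu>1 =
     {(\<mu>, \<psi>, h).
        (\<forall>t\<in>{0..1}. \<mu> t \<in> meas) \<and> abs_cont_curve 0 1 \<mu> \<and> \<mu> 0 = \<mu>0 \<and> \<mu> 1 = \<mu>1
        \<and> \<psi> \<in> borel_measurable (lebesgue_on {0..1})
        \<and> h \<in> borel_measurable (lebesgue_on {0..1})
        \<and> (AE t in lebesgue_on {0..1}. \<exists>d. (\<mu> has_vector_derivative d) (at t within {0..1})
              \<and> (\<forall>x. d $ x + (\<Sum>y\<in>UNIV. (\<psi> t $ y - \<psi> t $ x)
                                   * log_mean (\<mu> t $ x) (\<mu> t $ y) * K x y)
                     = h t * p $ x))}"

definition W_cost ::
  "('x::finite \<Rightarrow> 'x \<Rightarrow> real) \<Rightarrow> ('x \<Rightarrow> real) \<Rightarrow> real \<Rightarrow> real \<Rightarrow>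
   (real \<Rightarrow> real ^ 'x) \<Rightarrow> (real \<Rightarrow> real ^ 'x) \<Rightarrow> (real \<Rightarrow> real) \<Rightarrow> ennreal" where
  "W_cost K \<pi> a b \<mu> \<psi> h =
     ennreal (a\<^sup>2) * (\<integral>\<^sup>+ t. ennreal ((h t)\<^sup>2) \<partial>lebesgue_on {0..1})
     + ennreal (b\<^sup>2) * (\<integral>\<^sup>+ t. ennreal (1 / 2 * (\<Sum>x\<in>UNIV. \<Sum>y\<in>UNIV.
            (\<psi> t $ y - \<psi> t $ x)\<^sup>2 * log_mean (\<mu> t $ x) (\<mu> t $ y) * K x y * \<pi> x))
          \<partial>lebesgue_on {0..1})"

definition W_dist ::
  "('x::finite \<Rightarrow> 'x \<Rightarrow> real) \<Rightarrow> ('x \<Rightarrow> real) \<Rightarrow> real ^ 'x \<Rightarrow> real \<Rightarrow> real \<Rightarrow>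
   real ^ 'x \<Rightarrow> real ^ 'x \<Rightarrow> ennreal" where
  "W_dist K \<pi> p a b \<mu>0 \<mu>1 =
     esqrt (INF (\<mu>, \<psi>, h) \<in> W_curves K p \<mu>0 \<mu>1. W_cost K \<pi> a b \<mu> \<psi> h)"

definition ST ::
  "('x::finite \<Rightarrow> 'x \<Rightarrow> real) \<Rightarrow> ('x \<Rightarrow> real) \<Rightarrow> real ^ 'x \<Rightarrow> real ^ 'x \<Rightarrow> real ^ 'x \<Rightarrow>
   (real \<times> real \<times> (real \<Rightarrow> real ^ 'x) \<times> (real \<Rightarrow> real ^ 'x ^ 'x)) set" where
  "ST K \<pi> p \<mu>0 \<mu>1 =
     {(H0, H1, \<nu>, U).
        \<mu>0 + H0 *\<^sub>R p \<in> meas \<and> \<mu>1 + H1 *\<^sub>R p \<in> meas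
        \<and> wnorm1 \<pi> \<mu>0 + H0 = wnorm1 \<pi> \<mu>1 + H1
        \<and> (\<forall>t\<in>{0..1}. \<nu> t \<in> meas) \<and> abs_cont_curve 0 1 \<nu>
        \<and> U \<in> borel_measurable (lebesgue_on {0..1})
        \<and> (AE t in lebesgue_on {0..1}. \<exists>d. (\<nu> has_vector_derivative d) (at t within {0..1})
              \<and> d + divg K (U t) = 0)
        \<and> \<nu> 0 = \<mu>0 + H0 *\<^sub>R p \<and> \<nu> 1 = \<mu>1 + H1 *\<^sub>R p}"

definition D_dist ::
  "('x::finite \<Rightarrow> 'x \<Rightarrow> real) \<Rightarrow> ('x \<Rightarrow> real) \<Rightarrow> real ^ 'x \<Rightarrow> real \<Rightarrow> real \<Rightarrow>
   real ^ 'x \<Rightarrow> real ^ 'x \<Rightarrow> ennreal" where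
  "D_dist K \<pi> p a b \<mu>0 \<mu>1 =
     (INF (H0, H1, \<nu>, U) \<in> ST K \<pi> p \<mu>0 \<mu>1.
        esqrt (ennreal (a\<^sup>2 * (\<bar>H0\<bar> + \<bar>H1\<bar>)\<^sup>2)
               + ennreal (b\<^sup>2) * (\<integral>\<^sup>+ t. action' K \<pi> (\<nu> t) (U t) \<partial>lebesgue_on {0..1})))"

end

theory Submission
  imports Defs
begin

text \<open>
  Let \<open>(\<mu>, \<psi>, h)\<close> be a competitor for \<open>W\<close> and let \<open>m t\<close> be the total mass of \<open>\<mu> t\<close>.  Since \<open>K\<close> is
  reversible, the transport part of the evolution preserves mass and \<open>p\<close> has mass one, so \<open>m' = h\<close>
  almost everywhere.  For any upper bound \<open>C\<close> of \<open>m\<close>, all the shifting can be moved to the two end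
  points: \<open>\<nu> t = \<mu> t + (C - m t) p\<close> is a curve of nonnegative densities that solves the continuity
  equation with the momentum \<open>U(x, y) = (\<psi> y - \<psi> x) \<theta>(\<mu> x, \<mu> y)\<close> of the original curve
  (\<open>shifted_curve_in_ST\<close>).  The shifts used are \<open>C - m 0\<close> and \<open>C - m 1\<close>.  If \<open>C\<close> is the maximum of
  \<open>m\<close>, their sum is at most the variation of \<open>m\<close>, hence at most the \<open>L\<^sup>2\<close> norm of \<open>h\<close>.  Because the
  logarithmic mean is monotone and \<open>\<nu> \<ge> \<mu>\<close>, the action of \<open>\<nu>\<close> is at most the energy of the original
  curve.  This is the inequality \<open>D \<le> W\<close> (\<open>D_dist_sq_le_W_cost\<close>).

  A strict inequality has to survive the infimum defining \<open>W\<close>.  Therefore the gap between the two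
  costs is bounded below uniformly over all competitors whose cost is at most some \<open>\<Lambda>\<close>
  (\<open>D_dist_uniform_gap\<close>).  On such curves the densities are bounded, so that \<open>p \<ge> \<rho> \<mu>\<close> for a
  constant \<open>\<rho> > 0\<close>, and by homogeneity of the logarithmic mean the action of \<open>\<nu>\<close> at time \<open>t\<close> is at
  most \<open>e t / (1 + \<rho> (C - m t))\<close>, where \<open>e t\<close> is the energy at time \<open>t\<close>.  If \<open>\<mu>0 - \<mu>1\<close> is not a
  multiple of \<open>p\<close>, some mass must really be transported, which bounds the total energy from below.
  Let \<open>L\<close> be the sum of the two shifts for \<open>C = max m\<close>.  There are two cases
  (\<open>uniform_shift_gain\<close>).

  \<^item> If \<open>L\<close> is small, raise \<open>C\<close> by a small \<open>s\<close>: the energy drops by an amount of order \<open>s\<close>, while the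
    cost of shifting increases only by an amount of order \<open>s (L + s)\<close>.

  \<^item> If \<open>L\<close> is not small, take \<open>C = max m\<close>, attained at time \<open>r\<close>.  Either the Cauchy-Schwarz
    inequality between \<open>L\<^sup>2\<close> and the integral of \<open>h\<^sup>2\<close> has a definite defect, or \<open>C - m t\<close> is bounded
    below outside a short interval around \<open>r\<close>.  The energy cannot be concentrated on that interval,
    since transporting a given amount of mass in a short time is expensive, and the rest of the
    energy is reduced by a definite factor.

  A gap below the infimum only yields a strict inequality if \<open>D\<close> is finite.  By
  irreducibility every function of mean zero is a divergence (\<open>divg_surj\<close>), so after a large shift a
  straight line joins the end points with bounded action (\<open>D_dist_finite\<close>).
\<close>

section \<open>Absolutely continuous curves\<close>

lemma abs_cont_curve_ident: "abs_cont_curve l r (\<lambda>t::real. t)"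
  unfolding abs_cont_curve_def
proof (intro allI impI exI conjI)
  fix \<epsilon> :: real and I :: "(real \<times> real) set"
  assume I: "finite I \<and> (\<forall>(s, t)\<in>I. l \<le> s \<and> s < t \<and> t \<le> r)
        \<and> pairwise (\<lambda>i j. disjnt {fst i<..<snd i} {fst j<..<snd j}) I
        \<and> (\<Sum>(s, t)\<in>I. t - s) < \<epsilon>"
  then have "(\<Sum>(s, t)\<in>I. dist s t) = (\<Sum>(s, t)\<in>I. t - s)"
    by (intro sum.cong) (auto simp: dist_real_def)
  with I show "(\<Sum>(s, t)\<in>I. dist s t) < \<epsilon>" by simp
qed

text \<open>Linear functionals of a curve, in particular its components and its total mass, inherit absolute
  continuity through the following two lemmas.\<close>

lemma abs_cont_curve_lipschitz_image:
  assumes f: "abs_cont_curve l r f" and g: "\<And>u v. dist (g u) (g v) \<le> C * dist u v"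
  shows "abs_cont_curve l r (\<lambda>t. g (f t))"
  unfolding abs_cont_curve_def
proof (intro allI impI)
  fix \<epsilon> :: real assume "\<epsilon> > 0"
  define C' where "C' = \<bar>C\<bar> + 1"
  have C': "C' > 0" "dist (g u) (g v) \<le> C' * dist u v" for u v
    using order_trans[OF g mult_right_mono[of C C' "dist u v"]] by (auto simp: C'_def)
  have "\<epsilon> / C' > 0" using \<open>\<epsilon> > 0\<close> C' by simp
  with f obtain \<delta> where \<delta>: "\<delta> > 0" and *: "\<And>I. finite I
        \<and> (\<forall>(s, t)\<in>I. l \<le> s \<and> s < t \<and> t \<le> r)
        \<and> pairwise (\<lambda>i j. disjnt {fst i<..<snd i} {fst j<..<snd j}) I
        \<and> (\<Sum>(s, t)\<in>I. t - s) < \<delta>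
        \<Longrightarrow> (\<Sum>(s, t)\<in>I. dist (f s) (f t)) < \<epsilon> / C'"
    unfolding abs_cont_curve_def by meson
  show "\<exists>\<delta>>0. \<forall>I. finite I \<and> (\<forall>(s, t)\<in>I. l \<le> s \<and> s < t \<and> t \<le> r)
        \<and> pairwise (\<lambda>i j. disjnt {fst i<..<snd i} {fst j<..<snd j}) I
        \<and> (\<Sum>(s, t)\<in>I. t - s) < \<delta>
        \<longrightarrow> (\<Sum>(s, t)\<in>I. dist (g (f s)) (g (f t))) < \<epsilon>"
  proof (intro exI[of _ \<delta>] conjI allI impI \<delta>)
    fix I assume I: "finite I \<and> (\<forall>(s, t)\<in>I. l \<le> s \<and> s < t \<and> t \<le> r)
        \<and> pairwise (\<lambda>i j. disjnt {fst i<..<snd i} {fst j<..<snd j}) I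
        \<and> (\<Sum>(s, t)\<in>I. t - s) < \<delta>"
    have "(\<Sum>(s, t)\<in>I. dist (g (f s)) (g (f t))) \<le> C' * (\<Sum>(s, t)\<in>I. dist (f s) (f t))"
      unfolding sum_distrib_left by (intro sum_mono) (auto simp: C')
    also have "\<dots> < C' * (\<epsilon> / C')" using *[OF I] C' by (intro mult_strict_left_mono)
    finally show "(\<Sum>(s, t)\<in>I. dist (g (f s)) (g (f t))) < \<epsilon>" using C' by simp
  qed
qed

lemma abs_cont_curve_bounded_linear:
  assumes "abs_cont_curve l r f" "bounded_linear T"
  shows "abs_cont_curve l r (\<lambda>t. T (f t) + c)"
proof -
  interpret T: bounded_linear T by fact
  obtain C where "\<And>x. norm (T x) \<le> norm x * C" using T.bounded by blast
  then show ?thesis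
    by (intro abs_cont_curve_lipschitz_image[OF assms(1), of _ C])
      (simp add: dist_norm mult.commute flip: T.diff)
qed

lemma abs_cont_curve_subinterval:
  assumes "abs_cont_curve l r f" "l \<le> u" "v \<le> r"
  shows "abs_cont_curve u v f"
  unfolding abs_cont_curve_def
proof (intro allI impI)
  fix \<epsilon> :: real assume "\<epsilon> > 0"
  with assms(1) obtain \<delta> where \<delta>: "\<delta> > 0" and *: "\<And>I. finite I
        \<and> (\<forall>(s, t)\<in>I. l \<le> s \<and> s < t \<and> t \<le> r)
        \<and> pairwise (\<lambda>i j. disjnt {fst i<..<snd i} {fst j<..<snd j}) I
        \<and> (\<Sum>(s, t)\<in>I. t - s) < \<delta>
        \<Longrightarrow> (\<Sum>(s, t)\<in>I. dist (f s) (f t)) < \<epsilon>"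
    unfolding abs_cont_curve_def by meson
  have sub: "(\<forall>(s, t)\<in>I. l \<le> s \<and> s < t \<and> t \<le> r)" if "\<forall>(s, t)\<in>I. u \<le> s \<and> s < t \<and> t \<le> v" for I
    using that assms(2,3) by fastforce
  from sub have sub: "P \<and> (\<forall>(s, t)\<in>I. u \<le> s \<and> s < t \<and> t \<le> v) \<and> Q
      \<Longrightarrow> P \<and> (\<forall>(s, t)\<in>I. l \<le> s \<and> s < t \<and> t \<le> r) \<and> Q" for I P Q
    by blast
  show "\<exists>\<delta>>0. \<forall>I. finite I \<and> (\<forall>(s, t)\<in>I. u \<le> s \<and> s < t \<and> t \<le> v)
        \<and> pairwise (\<lambda>i j. disjnt {fst i<..<snd i} {fst j<..<snd j}) I
        \<and> (\<Sum>(s, t)\<in>I. t - s) < \<delta>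
        \<longrightarrow> (\<Sum>(s, t)\<in>I. dist (f s) (f t)) < \<epsilon>"
    using \<delta> *[OF sub] by blast
qed

lemma abs_cont_curve_imp_continuous_on:
  assumes "abs_cont_curve l r f"
  shows "continuous_on {l..r} f"
  unfolding continuous_on_iff
proof (intro ballI allI impI)
  fix s and \<epsilon> :: real assume s: "s \<in> {l..r}" and "\<epsilon> > 0"
  with assms obtain \<delta> where \<delta>: "\<delta> > 0" and *: "\<And>I. finite I
        \<and> (\<forall>(s, t)\<in>I. l \<le> s \<and> s < t \<and> t \<le> r)
        \<and> pairwise (\<lambda>i j. disjnt {fst i<..<snd i} {fst j<..<snd j}) I
        \<and> (\<Sum>(s, t)\<in>I. t - s) < \<delta>
        \<Longrightarrow> (\<Sum>(s, t)\<in>I. dist (f s) (f t)) < \<epsilon>"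
    unfolding abs_cont_curve_def by meson
  have "dist (f t) (f s) < \<epsilon>" if "t \<in> {l..r}" "dist t s < \<delta>" for t
    using that s \<open>\<epsilon> > 0\<close> *[of "{(s, t)}"] *[of "{(t, s)}"]
    by (cases t s rule: linorder_cases) (auto simp: dist_real_def dist_commute)
  with \<delta> show "\<exists>d>0. \<forall>t\<in>{l..r}. dist t s < d \<longrightarrow> dist (f t) (f s) < \<epsilon>" by blast
qed

text \<open>The fundamental theorem of calculus with a null exceptional set.  Work with the gauge integral: at a
  point of differentiability the gauge controls the error of the linear approximation, and around a
  point of \<open>N\<close> it stays inside an open superset of \<open>N\<close> of measure less than the \<open>\<delta>\<close> of absolute
  continuity.  The cells tagged in \<open>N\<close> then contribute little to the telescoping sum for
  \<open>f r - f l\<close>, and nothing to the Riemann sum once the derivative is replaced by zero on \<open>N\<close>.\<close>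

lemma abs_cont_has_integral_derivative:
  fixes f :: "real \<Rightarrow> 'a::banach"
  assumes ac: "abs_cont_curve l r f" and lr: "l \<le> r" and N: "negligible N"
    and deriv: "\<And>t. t \<in> {l..r} - N \<Longrightarrow> (f has_vector_derivative f' t) (at t within {l..r})"
  shows "(f' has_integral f r - f l) {l..r}"
proof -
  define g where "g t = (if t \<in> N then 0 else f' t)" for t
  have "(g has_integral f r - f l) (cbox l r)"
    unfolding has_integral
  proof (intro allI impI)
    fix e :: real assume "e > 0"
    define e1 where "e1 = e / (2 * (r - l + 1))"
    have e1: "e1 > 0" "e1 * (r - l) < e / 2"
      using \<open>e > 0\<close> lr by (auto simp: e1_def field_simps)
    have "e / 2 > 0" using \<open>e > 0\<close> by simp
    with ac obtain \<delta> where \<delta>: "\<delta> > 0" and ac': "\<And>I. finite I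
        \<and> (\<forall>(s, t)\<in>I. l \<le> s \<and> s < t \<and> t \<le> r)
        \<and> pairwise (\<lambda>i j. disjnt {fst i<..<snd i} {fst j<..<snd j}) I
        \<and> (\<Sum>(s, t)\<in>I. t - s) < \<delta>
        \<Longrightarrow> (\<Sum>(s, t)\<in>I. dist (f s) (f t)) < e / 2"
      unfolding abs_cont_curve_def by meson
    have "N \<in> sets lebesgue" using N by (simp add: negligible_imp_sets)
    from sets_lebesgue_outer_open[OF this \<delta>] obtain T
      where T: "open T" "N \<subseteq> T" "T - N \<in> lmeasurable" "emeasure lebesgue (T - N) < ennreal \<delta>" by metis
    have Teq: "T = (T - N) \<union> N" using T by auto
    have Tm: "T \<in> lmeasurable"
      using fmeasurable.Un[OF T(3) negligible_imp_measurable[OF N]] Teq by simp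
    have "measure lebesgue T \<le> measure lebesgue (T - N) + measure lebesgue N"
      by (subst Teq, intro measure_Un_le) (use T(3) N in \<open>auto simp: negligible_imp_sets\<close>)
    also have "\<dots> = measure lebesgue (T - N)" using N by (simp add: negligible_imp_measure0)
    also have "\<dots> < \<delta>" using T(3,4) \<delta> by (simp add: emeasure_eq_measure2 ennreal_less_iff)
    finally have Tlt: "measure lebesgue T < \<delta>" .
    have "\<forall>x. \<exists>d>0. (x \<in> N \<longrightarrow> ball x d \<subseteq> T) \<and> (x \<in> {l..r} - N \<longrightarrow>
         (\<forall>y\<in>{l..r}. norm (y-x) < d \<longrightarrow> norm (f y - f x - (y-x) *\<^sub>R f' x) \<le> e1 * norm (y-x)))"
    proof
      fix x
      show "\<exists>d>0. (x \<in> N \<longrightarrow> ball x d \<subseteq> T) \<and> (x \<in> {l..r} - N \<longrightarrow>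
         (\<forall>y\<in>{l..r}. norm (y-x) < d \<longrightarrow> norm (f y - f x - (y-x) *\<^sub>R f' x) \<le> e1 * norm (y-x)))"
      proof (cases "x \<in> N")
        case True
        then show ?thesis using T(1,2) by (meson Diff_iff openE subsetD)
      next
        case False
        then show ?thesis
          using deriv[of x, unfolded has_vector_derivative_def has_derivative_within_alt] e1(1)
          by (cases "x \<in> {l..r}") (auto intro: exI[of _ 1])
      qed
    qed
    then obtain d where d: "\<And>x. d x > 0" "\<And>x. x \<in> N \<Longrightarrow> ball x (d x) \<subseteq> T"
      "\<And>x y. x \<in> {l..r} - N \<Longrightarrow> y \<in> {l..r} \<Longrightarrow> norm (y-x) < d x
          \<Longrightarrow> norm (f y - f x - (y-x) *\<^sub>R f' x) \<le> e1 * norm (y-x)"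
      by metis
    show "\<exists>\<gamma>. gauge \<gamma> \<and> (\<forall>\<D>. \<D> tagged_division_of cbox l r \<and> \<gamma> fine \<D> \<longrightarrow>
            norm ((\<Sum>(x, k)\<in>\<D>. measure lborel k *\<^sub>R g x) - (f r - f l)) < e)"
    proof (intro exI conjI allI impI)
      show "gauge (\<lambda>x. ball x (d x))" using d(1) gauge_ball_dependent by blast
    next
      fix \<D> assume "\<D> tagged_division_of cbox l r \<and> (\<lambda>x. ball x (d x)) fine \<D>"
      then have ptag: "\<D> tagged_division_of cbox l r" and fine: "(\<lambda>x. ball x (d x)) fine \<D>" by auto
      have fin: "finite \<D>" using ptag by auto
      have ba: "r - l = (\<Sum>(x,K)\<in>\<D>. Sup K - Inf K)" "f r - f l = (\<Sum>(x,K)\<in>\<D>. f(Sup K) - f(Inf K))"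
        using additive_tagged_division_1[where f= "\<lambda>x. x"] additive_tagged_division_1[where f= f]
            lr ptag by auto
      have cell: "\<exists>u v. K = {u..v} \<and> u \<le> v \<and> l \<le> u \<and> v \<le> r \<and> u \<le> x \<and> x \<le> v" if "(x, K) \<in> \<D>" for x K
      proof -
        note tagged_division_ofD(2-4)[OF ptag that]
        then obtain u v where "K = {u..v}" "x \<in> {u..v}" "{u..v} \<subseteq> {l..r}" by auto
        then have "K = {u..v} \<and> u \<le> v \<and> l \<le> u \<and> v \<le> r \<and> u \<le> x \<and> x \<le> v" by auto
        then show ?thesis by blast
      qed
      have len: "Sup K - Inf K = measure lebesgue K" if "(x, K) \<in> \<D>" for x K
        using cell[OF that] by auto
      have sub: "l \<le> Inf K \<and> Sup K \<le> r" if "(x, K) \<in> \<D>" for x K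
        using cell[OF that] by auto
      \<comment> \<open>Degenerate cells are left out, so that distinct cells give distinct intervals.\<close>
      define A where "A = {q \<in> \<D>. fst q \<in> N \<and> Inf (snd q) < Sup (snd q)}"
      define J where "J q = (Inf (snd q), Sup (snd q))" for q :: "real \<times> real set"
      have AD: "A \<subseteq> \<D>" "finite A" using fin by (auto simp: A_def)
      have disj: "disjnt {fst (J q)<..<snd (J q)} {fst (J q')<..<snd (J q')}"
        if "q \<in> A" "q' \<in> A" "q \<noteq> q'" for q q'
      proof -
        obtain x K x' K' where q: "q = (x, K)" "q' = (x', K')" by fastforce
        with that AD have in': "(x, K) \<in> \<D>" "(x', K') \<in> \<D>" by auto
        have "interior K \<inter> interior K' = {}" using ptag in' that(3) q by (metis tagged_division_ofD(5))
        with cell[OF in'(1)] cell[OF in'(2)] show ?thesis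
          by (auto simp: q J_def disjnt_def)
      qed
      have inj: "inj_on J A"
      proof (rule inj_onI, rule ccontr)
        fix q q' assume q: "q \<in> A" "q' \<in> A" "J q = J q'" "q \<noteq> q'"
        from disj[OF q(1,2,4)] q have "{fst (J q)<..<snd (J q)} = {}" by (simp add: disjnt_def)
        with q(1) show False by (auto simp: A_def J_def)
      qed
      have AT: "K \<subseteq> T" if "(x, K) \<in> A" for x K
      proof -
        have "K \<subseteq> ball x (d x)" using fine that AD by blast
        then show ?thesis using that d(2)[of x] by (auto simp: A_def)
      qed
      have sumA: "(\<Sum>(s, t)\<in>J ` A. t - s) < \<delta>"
      proof -
        have div: "snd ` A division_of \<Union>(snd ` A)"
          using ptag AD(1) unfolding tagged_division_of_def
          by (blast intro: partial_division_of_tagged_division tagged_partial_division_subset)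
        have injs: "inj_on snd A"
          using inj by (auto simp: inj_on_def J_def)
        have "(\<Sum>(s, t)\<in>J ` A. t - s) = (\<Sum>q\<in>A. measure lebesgue (snd q))"
          using inj AD(1) 
          by (subst sum.reindex) (auto simp: J_def A_def len intro!: sum.cong)
        also have "\<dots> = (\<Sum>K\<in>snd ` A. measure lebesgue K)" using injs by (simp add: sum.reindex)
        also have "\<dots> = measure lebesgue (\<Union>(snd ` A))" using content_division[OF div] .
        also have "\<dots> \<le> measure lebesgue T"
          using AT lmeasurable_division[OF div] Tm by (intro measure_mono_fmeasurable) (fastforce simp: fmeasurableD)+
        finally show ?thesis using Tlt by simp
      qed
      have "(\<Sum>(s, t)\<in>J ` A. dist (f s) (f t)) < e / 2"
      proof (rule ac', intro conjI)
        show "\<forall>(s, t)\<in>J ` A. l \<le> s \<and> s < t \<and> t \<le> r"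
          by (auto simp: J_def A_def sub)
        show "pairwise (\<lambda>i j. disjnt {fst i<..<snd i} {fst j<..<snd j}) (J ` A)"
          using disj by (auto simp: pairwise_def)
      qed (use AD sumA in auto)
      then have Aless: "(\<Sum>(x, K)\<in>A. norm (f (Sup K) - f (Inf K))) < e / 2"
        using sum.reindex[OF inj, of "\<lambda>(s, t). dist (f s) (f t)"]
        by (simp add: J_def split_def dist_norm norm_minus_commute)
      \<comment> \<open>Tags outside \<open>N\<close> are charged to the length of the cell, tags in \<open>N\<close> to the increment of \<open>f\<close>.\<close>
      have cell_bound: "norm (measure lborel K *\<^sub>R g x - (f (Sup K) - f (Inf K)))
          \<le> e1 * (Sup K - Inf K) + (if (x, K) \<in> A then norm (f (Sup K) - f (Inf K)) else 0)"
        if xK: "(x, K) \<in> \<D>" for x K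
      proof -
        obtain u v where K: "K = {u..v}" "u \<le> v" "l \<le> u" "v \<le> r" "u \<le> x" "x \<le> v"
          using cell[OF xK] by auto
        show ?thesis
        proof (cases "x \<in> N")
          case True
          then show ?thesis using K xK e1(1) by (cases "u = v") (auto simp: g_def A_def norm_minus_commute)
        next
          case False
          have "K \<subseteq> ball x (d x)" using fine xK by blast
          then have uv: "norm (u - x) < d x" "norm (v - x) < d x"
            using K(2,5,6) subsetD[of K "ball x (d x)" u] subsetD[of K "ball x (d x)" v]
            by (auto simp: K(1) dist_real_def)
          have "norm (measure lborel K *\<^sub>R g x - (f (Sup K) - f (Inf K)))
              = norm (f u - f x - (u - x) *\<^sub>R f' x - (f v - f x - (v - x) *\<^sub>R f' x))"
            using False K by (simp add: g_def algebra_simps)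
          also have "\<dots> \<le> norm (f u - f x - (u - x) *\<^sub>R f' x) + norm (f v - f x - (v - x) *\<^sub>R f' x)"
            by (rule norm_triangle_ineq4)
          also have "\<dots> \<le> e1 * norm (u - x) + e1 * norm (v - x)"
            using uv K False by (intro add_mono d(3)) auto
          also have "\<dots> = e1 * (Sup K - Inf K)" using K by (simp add: algebra_simps)
          finally show ?thesis using False by (auto simp: A_def)
        qed
      qed
      have "norm ((\<Sum>(x, k)\<in>\<D>. measure lborel k *\<^sub>R g x) - (f r - f l))
          = norm (\<Sum>(x, K)\<in>\<D>. measure lborel K *\<^sub>R g x - (f (Sup K) - f (Inf K)))"
        unfolding ba(2) by (simp add: sum_subtractf split_def)
      also have "\<dots> \<le> (\<Sum>(x, K)\<in>\<D>. e1 * (Sup K - Inf K)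
              + (if (x, K) \<in> A then norm (f (Sup K) - f (Inf K)) else 0))"
        by (rule sum_norm_le) (use cell_bound in auto)
      also have "\<dots> = e1 * (r - l) + (\<Sum>(x, K)\<in>\<D>. if (x, K) \<in> A then norm (f (Sup K) - f (Inf K)) else 0)"
        unfolding ba(1) by (simp add: sum.distrib sum_distrib_left split_def)
      also have "(\<Sum>(x, K)\<in>\<D>. if (x, K) \<in> A then norm (f (Sup K) - f (Inf K)) else 0)
          = (\<Sum>(x, K)\<in>A. norm (f (Sup K) - f (Inf K)))"
        using AD fin by (simp add: split_def sum.inter_restrict[symmetric] Int_absorb1 flip: sum.inter_restrict)
      finally show "norm ((\<Sum>(x, k)\<in>\<D>. measure lborel k *\<^sub>R g x) - (f r - f l)) < e"
        using Aless e1(2) by simp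
    qed
  qed
  then have "(g has_integral f r - f l) {l..r}" by simp
  then show ?thesis
    by (rule has_integral_spike[OF N, rotated]) (auto simp: g_def)
qed

abbreviation unit_time :: "real measure" where "unit_time \<equiv> lebesgue_on {0..1}"

text \<open>The open interval in the bound makes the bounds over adjacent time intervals add up without any
  discussion of common end points.\<close>

lemma abs_cont_increment_le:
  fixes F f :: "real \<Rightarrow> real"
  assumes ac: "abs_cont_curve 0 1 F"
    and ae: "AE t in unit_time. (F has_vector_derivative f t) (at t within {0..1})"
    and f: "integrable unit_time f" and uv: "0 \<le> u" "u \<le> v" "v \<le> 1"
  shows "\<bar>F v - F u\<bar> \<le> (\<integral>t. indicator {u<..<v} t * \<bar>f t\<bar> \<partial>unit_time)"
proof -
  have "AE t in lebesgue. t \<in> {0..1} \<longrightarrow> (F has_vector_derivative f t) (at t within {0..1})"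
    using ae by (subst (asm) AE_restrict_space_iff) auto
  then obtain N where N2: "\<And>t. t \<in> space lebesgue - N \<Longrightarrow>
      t \<in> {0..1} \<longrightarrow> (F has_vector_derivative f t) (at t within {0..1})"
    and N: "N \<in> null_sets lebesgue"
    by (rule AE_E3) blast
  have "(f has_integral F v - F u) {u..v}"
  proof (rule abs_cont_has_integral_derivative)
    show "abs_cont_curve u v F" using abs_cont_curve_subinterval[OF ac] uv by simp
    show "negligible N" using N by (simp add: negligible_iff_null_sets)
    show "(F has_vector_derivative f t) (at t within {u..v})" if "t \<in> {u..v} - N" for t
      using that N2[of t] uv by (intro has_vector_derivative_within_subset[of F _ t "{0..1}" "{u..v}"]) auto
  qed (use uv in auto)
  then have I: "(f has_integral F v - F u) {u<..<v}" by (simp add: has_integral_Icc_iff_Ioo)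
  have sub: "{u<..<v} \<subseteq> {0..1}" using uv by auto
  have "integrable lebesgue (\<lambda>t. indicator {0..1} t *\<^sub>R f t)"
    using f by (subst (asm) integrable_restrict_space) auto
  then have "integrable lebesgue (\<lambda>t. indicator {u<..<v} t *\<^sub>R (indicator {0..1} t *\<^sub>R f t))"
    by (rule integrable_mult_indicator[rotated]) simp
  also have "(\<lambda>t. indicator {u<..<v} t *\<^sub>R (indicator {0..1} t *\<^sub>R f t)) = (\<lambda>t. indicator {u<..<v} t *\<^sub>R f t)"
    using sub by (auto simp: indicator_def fun_eq_iff)
  finally have fuv: "integrable (lebesgue_on {u<..<v}) f"
    by (subst integrable_restrict_space) auto
  have "F v - F u = (\<integral>t. f t \<partial>lebesgue_on {u<..<v})"
    using has_integral_unique[OF I has_integral_integral_lebesgue_on[OF fuv]] by simp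
  also have "\<bar>\<dots>\<bar> \<le> (\<integral>t. \<bar>f t\<bar> \<partial>lebesgue_on {u<..<v})" by (rule integral_abs_bound)
  also have "\<dots> = (\<integral>t. indicator {u<..<v} t *\<^sub>R \<bar>f t\<bar> \<partial>lebesgue)"
    by (rule integral_restrict_space) auto
  also have "\<dots> = (\<integral>t. indicator {0..1} t *\<^sub>R (indicator {u<..<v} t * \<bar>f t\<bar>) \<partial>lebesgue)"
    using sub by (intro Bochner_Integration.integral_cong) (auto simp: indicator_def)
  also have "\<dots> = (\<integral>t. indicator {u<..<v} t * \<bar>f t\<bar> \<partial>unit_time)"
    by (rule integral_restrict_space[symmetric]) auto
  finally show ?thesis .
qed

section \<open>The logarithmic mean\<close>

lemma log_mean_integrable: "(\<lambda>\<xi>. u powr \<xi> * v powr (1 - \<xi>)) integrable_on {0..1::real}"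
proof (cases "u = 0 \<or> v = 0")
  case False
  then show ?thesis by (intro integrable_continuous_real continuous_intros) auto
qed auto

lemma log_mean_nonneg: "0 \<le> log_mean u v"
  unfolding log_mean_def by (intro integral_nonneg log_mean_integrable) auto

lemma log_mean_mono:
  assumes "0 \<le> u" "u \<le> u'" "0 \<le> v" "v \<le> v'"
  shows "log_mean u v \<le> log_mean u' v'"
  unfolding log_mean_def
  by (intro integral_le log_mean_integrable mult_mono powr_mono2) (use assms in auto)

text \<open>Homogeneity of degree one, together with monotonicity, turns the comparison of densities
  \<open>\<nu> \<ge> (1 + q) \<mu>\<close> into the same comparison of logarithmic means.\<close>

lemma log_mean_scale:
  assumes "0 \<le> r" "0 \<le> u" "0 \<le> v"
  shows "log_mean (r * u) (r * v) = r * log_mean u v"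
proof (cases "r = 0")
  case False
  have "(r * u) powr \<xi> * (r * v) powr (1 - \<xi>) = r * (u powr \<xi> * v powr (1 - \<xi>))" for \<xi>
  proof -
    have "(r * u) powr \<xi> * (r * v) powr (1 - \<xi>)
        = (r powr \<xi> * r powr (1 - \<xi>)) * (u powr \<xi> * v powr (1 - \<xi>))"
      using assms by (simp add: powr_mult)
    also have "r powr \<xi> * r powr (1 - \<xi>) = r"
      using False assms by (simp flip: powr_add)
    finally show ?thesis .
  qed
  then show ?thesis by (simp add: log_mean_def)
qed (simp add: log_mean_zero)

lemma log_mean_commute: "0 \<le> u \<Longrightarrow> 0 \<le> v \<Longrightarrow> log_mean u v = log_mean v u"
  using log_mean_distinct[of u v] log_mean_distinct[of v u]
  by (cases "u = 0 \<or> v = 0 \<or> u = v") (auto simp: log_mean_zero minus_divide_divide[of "u - v", symmetric])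

lemma log_mean_ge: "0 \<le> m \<Longrightarrow> m \<le> u \<Longrightarrow> m \<le> v \<Longrightarrow> m \<le> log_mean u v"
  using log_mean_mono[of m u m v] by (simp add: log_mean_same)

lemma log_mean_le: "0 \<le> u \<Longrightarrow> 0 \<le> v \<Longrightarrow> u \<le> M \<Longrightarrow> v \<le> M \<Longrightarrow> log_mean u v \<le> M"
  using log_mean_mono[of u M v M] by (simp add: log_mean_same)

text \<open>On nonnegative arguments the parameter integral equals an explicit expression by cases, which is
  visibly Borel.\<close>

lemma borel_measurable_log_mean:
  assumes [measurable]: "f \<in> borel_measurable M" "g \<in> borel_measurable M"
    and nn: "\<And>x. x \<in> space M \<Longrightarrow> 0 \<le> f x \<and> 0 \<le> g x"
  shows "(\<lambda>x. log_mean (f x) (g x)) \<in> borel_measurable M"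
proof -
  have "log_mean (f x) (g x) = (if f x = 0 \<or> g x = 0 then 0 else if f x = g x then f x
          else (f x - g x) / (ln (f x) - ln (g x)))" if "x \<in> space M" for x
    using nn[OF that] log_mean_distinct[of "f x" "g x"] log_mean_same[of "f x"]
    by (auto simp: log_mean_zero)
  then show ?thesis by (subst measurable_cong) measurable
qed

lemma log_mean_expand:
  assumes "0 \<le> u" "0 \<le> v" "0 \<le> q" "(1 + q) * u \<le> u'" "(1 + q) * v \<le> v'"
  shows "(1 + q) * log_mean u v \<le> log_mean u' v'"
  using assms log_mean_mono[of "(1 + q) * u" u' "(1 + q) * v" v'] by (simp add: log_mean_scale)

text \<open>The flux \<open>w \<theta>(u, v)\<close> has action density \<open>w\<^sup>2 \<theta>(u, v)\<close> with respect to \<open>(u, v)\<close> itself.  Keeping the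
  flux and increasing the densities only increases the denominator.  If \<open>\<theta>(u, v) = 0\<close> the flux
  vanishes, so the infinite value of the density does not occur.\<close>

lemma action_dens_expand:
  assumes "0 \<le> u" "0 \<le> v" "0 \<le> q" "(1 + q) * u \<le> u'" "(1 + q) * v \<le> v'"
  shows "action_dens (w * log_mean u v) u' v' \<le> ennreal (w\<^sup>2 * log_mean u v / (1 + q))"
proof -
  note le = log_mean_expand[OF assms]
  consider "log_mean u v = 0" | "0 < log_mean u v" using log_mean_nonneg[of u v] by fastforce
  then show ?thesis
  proof cases
    case 1
    then show ?thesis by (simp add: action_dens_def)
  next
    case 2
    then have pos: "0 < (1 + q) * log_mean u v" using assms by simp
    from le pos have pos': "0 < log_mean u' v'" by linarith
    have "(w * log_mean u v)\<^sup>2 / log_mean u' v' \<le> (w * log_mean u v)\<^sup>2 / ((1 + q) * log_mean u v)"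
      by (rule divide_left_mono[OF le]) (use pos pos' in auto)
    also have "\<dots> = w\<^sup>2 * log_mean u v / (1 + q)"
      using 2 by (simp add: power2_eq_square)
    finally show ?thesis using pos' by (simp add: action_dens_pos ennreal_leI)
  qed
qed

section \<open>Quantitative gain from a shift\<close>

lemma integrable_indicator_mult:
  fixes f :: "'a \<Rightarrow> real"
  assumes "A \<in> sets M" "integrable M f"
  shows "integrable M (\<lambda>x. indicator A x * f x)"
  using integrable_real_mult_indicator[OF assms] by (subst mult.commute)

lemma abs_le_one_plus_square: "\<bar>y\<bar> \<le> 1 + y\<^sup>2" for y :: real
  using zero_le_power2[of "\<bar>y\<bar> - 1"] by (simp add: power2_diff)

text \<open>The quadratic polynomial \<open>k \<mapsto> \<integral> (\<bar>f\<bar> - k)\<^sup>2\<close> over \<open>A\<close> is nonnegative, so its discriminant is not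
  positive.\<close>

lemma finite_measure_Cauchy_Schwarz:
  assumes "finite_measure M" and A: "A \<in> sets M" and [measurable]: "f \<in> borel_measurable M"
    and sq: "integrable M (\<lambda>x. (f x)\<^sup>2)"
  shows "integrable M (\<lambda>x. \<bar>f x\<bar> :: real)"
    and "(\<integral>x. indicator A x * \<bar>f x\<bar> \<partial>M)\<^sup>2 \<le> measure M A * (\<integral>x. indicator A x * (f x)\<^sup>2 \<partial>M)"
proof -
  interpret finite_measure M by fact
  show int: "integrable M (\<lambda>x. \<bar>f x\<bar>)"
    by (rule Bochner_Integration.integrable_bound[of _ "\<lambda>x. 1 + (f x)\<^sup>2"]) (use sq abs_le_one_plus_square in auto)
  note [measurable] = A
  define F1 F2 where "F1 = (\<integral>x. indicator A x * \<bar>f x\<bar> \<partial>M)"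
    and "F2 = (\<integral>x. indicator A x * (f x)\<^sup>2 \<partial>M)"
  have i1: "integrable M (\<lambda>x. indicator A x * \<bar>f x\<bar>)" and i2: "integrable M (\<lambda>x. indicator A x * (f x)\<^sup>2)"
    using int sq A by (auto intro: integrable_indicator_mult)
  have i0: "integrable M (indicat_real A)"
    using A by (simp add: integrable_indicator_iff less_top[symmetric])
  have quad: "0 \<le> F2 - 2 * k * F1 + k\<^sup>2 * measure M A" for k
  proof -
    have "0 \<le> (\<integral>x. indicator A x * (\<bar>f x\<bar> - k)\<^sup>2 \<partial>M)" by simp
    also have "\<dots> = (\<integral>x. indicator A x * (f x)\<^sup>2 - 2 * k * (indicator A x * \<bar>f x\<bar>) + k\<^sup>2 * indicator A x \<partial>M)"
      by (intro Bochner_Integration.integral_cong) (auto simp: power2_diff algebra_simps)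
    also have "\<dots> = F2 - 2 * k * F1 + k\<^sup>2 * measure M A"
      using i0 i1 i2 A sets.sets_into_space[OF A] by (simp add: F1_def F2_def Int_absorb2)
    finally show ?thesis .
  qed
  have "0 \<le> F1" by (simp add: F1_def)
  show "(\<integral>x. indicator A x * \<bar>f x\<bar> \<partial>M)\<^sup>2 \<le> measure M A * (\<integral>x. indicator A x * (f x)\<^sup>2 \<partial>M)"
    unfolding F1_def[symmetric] F2_def[symmetric]
  proof (cases "measure M A = 0")
    case True
    have "F1 = 0"
    proof (rule ccontr)
      assume "F1 \<noteq> 0"
      with quad[of "(F2 + 1) / (2 * F1)"] True show False by simp
    qed
    then show "F1\<^sup>2 \<le> measure M A * F2" using True by simp
  next
    case False
    then have pos: "0 < measure M A" by (simp add: less_le)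
    have "0 \<le> measure M A * (F2 - 2 * (F1 / measure M A) * F1 + (F1 / measure M A)\<^sup>2 * measure M A)"
      using quad[of "F1 / measure M A"] pos by simp
    also have "\<dots> = measure M A * F2 - F1\<^sup>2"
      using pos by (simp add: power2_eq_square field_simps)
    finally show "F1\<^sup>2 \<le> measure M A * F2" by simp
  qed
qed

lemma finite_measure_unit_time: "finite_measure unit_time"
  by (rule finite_measure_lebesgue_on) simp

lemma measure_unit_time: "A \<in> sets unit_time \<Longrightarrow> measure unit_time A = measure lebesgue A"
  by (subst measure_restrict_space) (auto simp: sets_restrict_space)

text \<open>Raising the bound \<open>C\<close> by \<open>s\<close>.  The energy drops at least to the fraction \<open>1 / (1 + \<rho> s)\<close>, a gain of
  order \<open>s\<close>, while the square of the sum of the shifts grows by \<open>4 s (L + s) \<le> 8 s\<^sup>2\<close>.  The smallness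
  condition on \<open>s\<close> makes the loss at most half of the gain.\<close>

lemma small_shift_gain:
  fixes e m :: "real \<Rightarrow> real"
  assumes "0 < \<rho>" "0 < s" "s \<le> 1" "0 < E0"
    and s: "16 * a\<^sup>2 * s \<le> b\<^sup>2 * E0 * \<rho> / (1 + \<rho>)"
    and e: "integrable unit_time e" "\<And>t. 0 \<le> e t" and [measurable]: "m \<in> borel_measurable unit_time"
    and C: "\<And>t. t \<in> {0..1} \<Longrightarrow> m t \<le> C"
    and L: "2 * C - m 0 - m 1 \<le> s" "(2 * C - m 0 - m 1)\<^sup>2 \<le> X"
    and E0: "E0 \<le> (\<integral>t. e t \<partial>unit_time)"
  shows "a\<^sup>2 * (2 * (C + s) - m 0 - m 1)\<^sup>2 + b\<^sup>2 * (\<integral>t. e t / (1 + \<rho> * (C + s - m t)) \<partial>unit_time)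
      + s * (b\<^sup>2 * E0 * \<rho> / (1 + \<rho>)) / 2 \<le> a\<^sup>2 * X + b\<^sup>2 * (\<integral>t. e t \<partial>unit_time)"
proof -
  define E where "E = (\<integral>t. e t \<partial>unit_time)"
  define c1 where "c1 = b\<^sup>2 * E0 * \<rho> / (1 + \<rho>)"
  define L where "L = 2 * C - m 0 - m 1"
  have [measurable]: "e \<in> borel_measurable unit_time" using e(1) by auto
  have pw: "e t / (1 + \<rho> * (C + s - m t)) \<le> e t / (1 + \<rho> * s)" if "t \<in> {0..1}" for t
    using C[OF that] e(2)[of t] assms(1,2)
    by (intro divide_left_mono mult_pos_pos) (auto intro!: add_pos_nonneg add_pos_pos)
  have "(\<integral>t. e t / (1 + \<rho> * (C + s - m t)) \<partial>unit_time) \<le> (\<integral>t. e t / (1 + \<rho> * s) \<partial>unit_time)"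
    using e pw assms(1,2) by (intro integral_mono') (auto intro!: divide_nonneg_nonneg add_nonneg_nonneg)
  also have "\<dots> = E / (1 + \<rho> * s)" by (simp add: E_def)
  finally have 1: "(\<integral>t. e t / (1 + \<rho> * (C + s - m t)) \<partial>unit_time) \<le> E / (1 + \<rho> * s)" .
  have "E0 * (\<rho> * s / (1 + \<rho>)) \<le> E * (\<rho> * s / (1 + \<rho> * s))"
    using assms(1-4) E0 by (intro mult_mono divide_left_mono) (auto simp: E_def mult_left_le intro!: mult_pos_pos add_pos_pos)
  also have "\<dots> = E - E / (1 + \<rho> * s)" using assms(1,2)
    by (simp add: field_simps add_pos_pos[THEN less_imp_neq, symmetric])
  finally have 2: "b\<^sup>2 * (E / (1 + \<rho> * s)) \<le> b\<^sup>2 * (E - E0 * (\<rho> * s / (1 + \<rho>)))"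
    by (intro mult_left_mono) auto
  have 3: "b\<^sup>2 * (E - E0 * (\<rho> * s / (1 + \<rho>))) = b\<^sup>2 * E - s * c1"
    by (simp add: c1_def algebra_simps)
  have "(2 * (C + s) - m 0 - m 1)\<^sup>2 = L\<^sup>2 + 4 * s * (L + s)"
    by (simp add: L_def power2_eq_square algebra_simps)
  also have "\<dots> \<le> X + 4 * s * (s + s)"
    using L assms(2) by (intro add_mono mult_left_mono) (auto simp: L_def)
  finally have 4: "a\<^sup>2 * (2 * (C + s) - m 0 - m 1)\<^sup>2 \<le> a\<^sup>2 * (X + 8 * s * s)"
    by (intro mult_left_mono) auto
  have 5: "s * (16 * a\<^sup>2 * s) \<le> s * c1" using s assms(2) by (intro mult_left_mono) (auto simp: c1_def)
  have 6: "b\<^sup>2 * (\<integral>t. e t / (1 + \<rho> * (C + s - m t)) \<partial>unit_time) \<le> b\<^sup>2 * (E / (1 + \<rho> * s))"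
    using 1 by (intro mult_left_mono) auto
  have "a\<^sup>2 * (X + 8 * s * s) = a\<^sup>2 * X + s * (16 * a\<^sup>2 * s) / 2" by (simp add: algebra_simps)
  with 2 3 4 5 6 show ?thesis unfolding c1_def[symmetric] E_def[symmetric] by linarith
qed

text \<open>The two increments on the left only use the times outside \<open>[u, v]\<close>, a set of measure
  \<open>1 - (v - u)\<close>.  For \<open>u = v\<close> the maximal time of \<open>m\<close> this bounds the shifts by \<open>h\<close>, and for
  \<open>u < v\<close> it gains a factor that forces \<open>m\<close> to stay away from its maximum far from the maximal time.\<close>

lemma outer_increments_le:
  fixes h m :: "real \<Rightarrow> real"
  assumes h: "h \<in> borel_measurable unit_time" "integrable unit_time (\<lambda>t. (h t)\<^sup>2)"
    and incr: "\<And>u v. 0 \<le> u \<Longrightarrow> u \<le> v \<Longrightarrow> v \<le> 1 \<Longrightarrow>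
      \<bar>m v - m u\<bar> \<le> (\<integral>t. indicator {u<..<v} t * \<bar>h t\<bar> \<partial>unit_time)"
    and uv: "0 \<le> u" "u \<le> v" "v \<le> 1"
  shows "(\<bar>m u - m 0\<bar> + \<bar>m v - m 1\<bar>)\<^sup>2 \<le> (1 - (v - u)) * (\<integral>t. (h t)\<^sup>2 \<partial>unit_time)"
proof -
  define A where "A = {0<..<u} \<union> {v<..<1}"
  have A: "A \<in> sets unit_time" and sub: "{0<..<u} \<in> sets unit_time" "{v<..<1} \<in> sets unit_time"
    using uv by (auto simp: A_def sets_restrict_space_iff)
  have mA: "measure unit_time A = 1 - (v - u)"
  proof -
    have "measure lebesgue A = measure lebesgue {0<..<u} + measure lebesgue {v<..<1}"
      unfolding A_def using uv by (intro measure_Un_AE) auto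
    then show ?thesis using A uv by (simp add: measure_unit_time)
  qed
  note CS = finite_measure_Cauchy_Schwarz[OF finite_measure_unit_time A h]
  have int: "integrable unit_time (\<lambda>t. indicator B t * \<bar>h t\<bar>)" if "B \<in> sets unit_time" for B
    using integrable_indicator_mult[OF that CS(1)] .
  have "\<bar>m u - m 0\<bar> + \<bar>m v - m 1\<bar>
      \<le> (\<integral>t. indicator {0<..<u} t * \<bar>h t\<bar> \<partial>unit_time) + (\<integral>t. indicator {v<..<1} t * \<bar>h t\<bar> \<partial>unit_time)"
    using incr[of 0 u] incr[of v 1] uv by (simp add: abs_minus_commute)
  also have "\<dots> = (\<integral>t. indicator A t * \<bar>h t\<bar> \<partial>unit_time)"
    using uv unfolding Bochner_Integration.integral_add[OF int[OF sub(1)] int[OF sub(2)], symmetric]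
    by (intro Bochner_Integration.integral_cong) (auto simp: A_def indicator_def)
  finally have "(\<bar>m u - m 0\<bar> + \<bar>m v - m 1\<bar>)\<^sup>2 \<le> (\<integral>t. indicator A t * \<bar>h t\<bar> \<partial>unit_time)\<^sup>2"
    by (intro power_mono) auto
  also have "\<dots> \<le> (1 - (v - u)) * (\<integral>t. indicator A t * (h t)\<^sup>2 \<partial>unit_time)"
    using CS(2) by (simp add: mA)
  also have "\<dots> \<le> (1 - (v - u)) * (\<integral>t. (h t)\<^sup>2 \<partial>unit_time)"
    using uv h by (intro mult_left_mono integral_mono') (auto simp: indicator_def)
  finally show ?thesis .
qed

lemma max_increments_sq_le:
  fixes h m :: "real \<Rightarrow> real"
  assumes h: "h \<in> borel_measurable unit_time" "integrable unit_time (\<lambda>t. (h t)\<^sup>2)"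
    and incr: "\<And>u v. 0 \<le> u \<Longrightarrow> u \<le> v \<Longrightarrow> v \<le> 1 \<Longrightarrow>
      \<bar>m v - m u\<bar> \<le> (\<integral>t. indicator {u<..<v} t * \<bar>h t\<bar> \<partial>unit_time)"
    and r: "r \<in> {0..1}" "\<And>t. t \<in> {0..1} \<Longrightarrow> m t \<le> m r"
  shows "(2 * m r - m 0 - m 1)\<^sup>2 \<le> (\<integral>t. (h t)\<^sup>2 \<partial>unit_time)"
proof -
  have "(2 * m r - m 0 - m 1)\<^sup>2 \<le> (\<bar>m r - m 0\<bar> + \<bar>m r - m 1\<bar>)\<^sup>2"
    using r(2)[of 0] r(2)[of 1] by (intro power_mono) auto
  also have "\<dots> \<le> (1 - (r - r)) * (\<integral>t. (h t)\<^sup>2 \<partial>unit_time)"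
    using r(1) by (intro outer_increments_le[OF h incr]) auto
  finally show ?thesis by simp
qed

text \<open>Here \<open>f\<close> is a velocity controlled by the energy \<open>e\<close>, and \<open>\<zeta>\<close> a distance that has to be covered.
  In the time interval of length \<open>2 \<tau>\<close> around \<open>r\<close>, Cauchy-Schwarz allows at most the distance
  \<open>\<zeta> / 2\<close> with the available energy \<open>E1\<close>.  The other half is covered elsewhere, which costs energy
  there.\<close>

lemma energy_outside_short_interval:
  fixes e f :: "real \<Rightarrow> real"
  assumes "0 < B" "0 < \<zeta>" "0 < \<tau>" and \<tau>: "8 * \<tau> * B * E1 \<le> \<zeta>\<^sup>2"
    and e: "integrable unit_time e" "\<And>t. 0 \<le> e t" "(\<integral>t. e t \<partial>unit_time) \<le> E1"
    and f: "f \<in> borel_measurable unit_time" "\<And>t. t \<in> {0..1} \<Longrightarrow> (f t)\<^sup>2 \<le> B * e t"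
    and \<zeta>: "\<zeta> \<le> (\<integral>t. \<bar>f t\<bar> \<partial>unit_time)"
  shows "\<zeta>\<^sup>2 / (4 * B) \<le> (\<integral>t. indicator {t \<in> {0..1}. \<tau> \<le> \<bar>t - r\<bar>} t * e t \<partial>unit_time)"
proof -
  define A where "A = {t \<in> {0..1}. \<tau> \<le> \<bar>t - r\<bar>}"
  define N where "N = {0..1} \<inter> {r - \<tau><..<r + \<tau>}"
  have N: "N \<in> sets unit_time" by (auto simp: N_def sets_restrict_space_iff)
  have "A = {0..1} - N" by (auto simp: A_def N_def)
  then have A: "A \<in> sets unit_time" using N by (auto simp: sets_restrict_space_iff)
  have Be: "0 \<le> B * e t" for t using e(2) assms(1) by simp
  have f2: "integrable unit_time (\<lambda>t. (f t)\<^sup>2)"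
    by (rule Bochner_Integration.integrable_bound[of _ "\<lambda>t. B * e t"])
      (use e f in \<open>auto simp: abs_of_nonneg[OF Be]\<close>)
  have sqle: "(\<integral>t. indicator S t * (f t)\<^sup>2 \<partial>unit_time) \<le> B * (\<integral>t. indicator S t * e t \<partial>unit_time)"
    if S: "S \<in> sets unit_time" for S
  proof -
    have "(\<integral>t. indicator S t * (f t)\<^sup>2 \<partial>unit_time) \<le> (\<integral>t. B * (indicator S t * e t) \<partial>unit_time)"
      using S e f integrable_indicator_mult[OF S e(1)]
      by (intro integral_mono') (auto simp: indicator_def Be)
    then show ?thesis by simp
  qed
  note CSN = finite_measure_Cauchy_Schwarz[OF finite_measure_unit_time N f(1) f2]
  note CSA = finite_measure_Cauchy_Schwarz[OF finite_measure_unit_time A f(1) f2]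
  define fN where "fN = (\<integral>t. indicator N t * \<bar>f t\<bar> \<partial>unit_time)"
  define fA where "fA = (\<integral>t. indicator A t * \<bar>f t\<bar> \<partial>unit_time)"
  have split: "(\<integral>t. \<bar>f t\<bar> \<partial>unit_time) = fN + fA"
    unfolding fN_def fA_def Bochner_Integration.integral_add[OF integrable_indicator_mult[OF N CSN(1)]
        integrable_indicator_mult[OF A CSN(1)], symmetric]
    by (intro Bochner_Integration.integral_cong) (auto simp: A_def N_def indicator_def)
  have "measure unit_time N \<le> measure lebesgue {r - \<tau><..<r + \<tau>}"
    unfolding measure_unit_time[OF N] by (intro measure_mono_fmeasurable) (auto simp: N_def)
  then have mN: "measure unit_time N \<le> 2 * \<tau>" using assms(3) by simp
  have mA: "measure unit_time A \<le> 1"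
    using finite_measure.bounded_measure[OF finite_measure_unit_time, of A] by (simp add: measure_unit_time)
  have eN: "(\<integral>t. indicator N t * e t \<partial>unit_time) \<le> E1"
    using e by (intro order_trans[OF integral_mono' e(3)]) (auto simp: indicator_def)
  have "fN\<^sup>2 \<le> measure unit_time N * (\<integral>t. indicator N t * (f t)\<^sup>2 \<partial>unit_time)"
    unfolding fN_def by (rule CSN)
  also have "\<dots> \<le> (2 * \<tau>) * (B * E1)"
    using mN assms(1,3) eN by (intro mult_mono order_trans[OF sqle[OF N]] mult_left_mono) auto
  also have "\<dots> \<le> (\<zeta> / 2)\<^sup>2" using \<tau> by (simp add: power_divide)
  finally have "fN \<le> \<zeta> / 2" using assms(2) by (intro power2_le_imp_le[of fN]) auto
  then have "\<zeta> / 2 \<le> fA" using \<zeta> split by simp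
  then have "(\<zeta> / 2)\<^sup>2 \<le> fA\<^sup>2" using assms(2) by (intro power_mono) auto
  also have "\<dots> \<le> measure unit_time A * (\<integral>t. indicator A t * (f t)\<^sup>2 \<partial>unit_time)"
    unfolding fA_def by (rule CSA)
  also have "\<dots> \<le> 1 * (B * (\<integral>t. indicator A t * e t \<partial>unit_time))"
    using mA by (intro mult_mono sqle A) auto
  finally show ?thesis unfolding A_def[symmetric] using assms(1) by (simp add: field_simps power_divide)
qed

text \<open>On \<open>A\<close> the energy is multiplied by at most \<open>1 / (1 + \<rho> \<kappa>) = 1 - \<rho> \<kappa> / (1 + \<rho> \<kappa>)\<close>; elsewhere it
  does not increase.\<close>

lemma large_shift_gain:
  fixes e m :: "real \<Rightarrow> real"
  assumes "0 < \<rho>" "0 \<le> \<kappa>"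
    and e: "integrable unit_time e" "\<And>t. 0 \<le> e t" and [measurable]: "m \<in> borel_measurable unit_time"
    and C: "\<And>t. t \<in> {0..1} \<Longrightarrow> m t \<le> C" and A: "A \<in> sets unit_time"
    and \<kappa>: "\<And>t. t \<in> A \<Longrightarrow> \<kappa> \<le> C - m t"
  shows "(\<integral>t. e t / (1 + \<rho> * (C - m t)) \<partial>unit_time)
    \<le> (\<integral>t. e t \<partial>unit_time) - \<rho> * \<kappa> / (1 + \<rho> * \<kappa>) * (\<integral>t. indicator A t * e t \<partial>unit_time)"
proof -
  define q where "q = \<rho> * \<kappa> / (1 + \<rho> * \<kappa>)"
  have pos: "0 < 1 + \<rho> * \<kappa>" using assms(1,2) by (simp add: add_pos_nonneg)
  have q: "e t / (1 + \<rho> * \<kappa>) = e t - q * e t" for t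
    using pos by (simp add: q_def field_simps)
  have "q \<le> 1" using pos by (simp add: q_def)
  have [measurable]: "e \<in> borel_measurable unit_time" using e(1) by auto
  have iA: "integrable unit_time (\<lambda>t. indicator A t * e t)"
    using integrable_indicator_mult[OF A e(1)] .
  have pw: "e t / (1 + \<rho> * (C - m t)) \<le> e t - q * (indicator A t * e t)" if t: "t \<in> {0..1}" for t
  proof (cases "t \<in> A")
    case True
    have "e t / (1 + \<rho> * (C - m t)) \<le> e t / (1 + \<rho> * \<kappa>)"
      using \<kappa>[OF True] pos C[OF t] e(2)[of t] assms(1)
      by (intro divide_left_mono mult_pos_pos) (auto intro!: add_pos_nonneg)
    then show ?thesis using True by (simp add: q)
  next
    case False
    have "e t / (1 + \<rho> * (C - m t)) \<le> e t / 1"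
      using C[OF t] e(2)[of t] assms(1) by (intro divide_left_mono) (auto intro!: add_pos_nonneg)
    then show ?thesis using False by simp
  qed
  have nn: "0 \<le> e t - q * (indicator A t * e t)" for t
    using e(2)[of t] mult_right_mono[OF \<open>q \<le> 1\<close>, of "e t"] by (auto simp: indicator_def)
  have "(\<integral>t. e t / (1 + \<rho> * (C - m t)) \<partial>unit_time) \<le> (\<integral>t. e t - q * (indicator A t * e t) \<partial>unit_time)"
    using e iA pw nn by (intro integral_mono') auto
  also have "\<dots> = (\<integral>t. e t \<partial>unit_time) - q * (\<integral>t. indicator A t * e t \<partial>unit_time)"
    using e iA by simp
  finally show ?thesis by (simp add: q_def)
qed

text \<open>The analytic core: \<open>\<delta>\<close> depends on the bounds only, not on the curve.  The function \<open>m\<close> is the total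
  mass, with derivative \<open>h\<close>; \<open>e\<close> is the energy; \<open>f\<close> is the velocity of one coordinate of the
  transported density.  The two cases are distinguished by comparing \<open>L = 2 max m - m 0 - m 1\<close> with
  the threshold \<open>s\<close>, which serves also as the additional shift in the first case.\<close>

lemma uniform_shift_gain:
  fixes a b \<Lambda> B \<zeta> \<rho> :: real
  assumes pos: "0 < a" "0 < b" "0 < \<Lambda>" "0 < B" "0 < \<zeta>" "0 < \<rho>"
  obtains \<delta> where "0 < \<delta>" and "\<And>h e f m.
      h \<in> borel_measurable unit_time \<Longrightarrow> integrable unit_time (\<lambda>t. (h t)\<^sup>2) \<Longrightarrow>
      integrable unit_time e \<Longrightarrow> (\<And>t. 0 \<le> e t) \<Longrightarrow>
      f \<in> borel_measurable unit_time \<Longrightarrow> (\<And>t. t \<in> {0..1} \<Longrightarrow> (f t)\<^sup>2 \<le> B * e t) \<Longrightarrow>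
      continuous_on {0..1} m \<Longrightarrow>
      (\<And>u v. 0 \<le> u \<Longrightarrow> u \<le> v \<Longrightarrow> v \<le> 1 \<Longrightarrow>
         \<bar>m v - m u\<bar> \<le> (\<integral>t. indicator {u<..<v} t * \<bar>h t\<bar> \<partial>unit_time)) \<Longrightarrow>
      \<zeta> \<le> (\<integral>t. \<bar>f t\<bar> \<partial>unit_time) \<Longrightarrow>
      a\<^sup>2 * (\<integral>t. (h t)\<^sup>2 \<partial>unit_time) + b\<^sup>2 * (\<integral>t. e t \<partial>unit_time) \<le> \<Lambda> \<Longrightarrow>
      \<exists>C. (\<forall>t\<in>{0..1}. m t \<le> C) \<and>
        a\<^sup>2 * (2 * C - m 0 - m 1)\<^sup>2 + b\<^sup>2 * (\<integral>t. e t / (1 + \<rho> * (C - m t)) \<partial>unit_time) + \<delta>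
        \<le> a\<^sup>2 * (\<integral>t. (h t)\<^sup>2 \<partial>unit_time) + b\<^sup>2 * (\<integral>t. e t \<partial>unit_time)"
proof -
  \<comment> \<open>\<open>E0\<close> bounds the energy from below, \<open>c1\<close> is the rate of the gain in \<open>small_shift_gain\<close>, \<open>\<tau>\<close> is the
    half length that meets the condition of \<open>energy_outside_short_interval\<close>, and the three
    candidates for \<open>\<delta>\<close> belong to the three cases of the proof.\<close>
  define E0 where "E0 = \<zeta>\<^sup>2 / B"
  define c1 where "c1 = b\<^sup>2 * E0 * \<rho> / (1 + \<rho>)"
  define s where "s = min 1 (c1 / (16 * a\<^sup>2))"
  define \<tau> where "\<tau> = min (1 / 2) (\<zeta>\<^sup>2 * b\<^sup>2 / (8 * B * \<Lambda>))"
  define \<kappa> where "\<kappa> = \<tau> * s / 2"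
  define \<delta>1 \<delta>2 \<delta>3 where "\<delta>1 = s * c1 / 2" and "\<delta>2 = a\<^sup>2 * (\<tau>\<^sup>2 * s\<^sup>2 / 4)"
    and "\<delta>3 = b\<^sup>2 * (\<rho> * \<kappa> / (1 + \<rho> * \<kappa>) * (\<zeta>\<^sup>2 / (4 * B)))"
  have "0 < E0" using pos by (simp add: E0_def)
  then have "0 < c1" using pos by (simp add: c1_def)
  then have "0 < s" "s \<le> 1" using pos by (auto simp: s_def)
  have s16: "16 * a\<^sup>2 * s \<le> c1"
    using mult_left_mono[of s "c1 / (16 * a\<^sup>2)" "16 * a\<^sup>2"] pos by (simp add: s_def)
  have "0 < \<tau>" "\<tau> < 1" using pos by (auto simp: \<tau>_def)
  have \<tau>8: "8 * \<tau> * B * (\<Lambda> / b\<^sup>2) \<le> \<zeta>\<^sup>2"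
    using mult_left_mono[of \<tau> "\<zeta>\<^sup>2 * b\<^sup>2 / (8 * B * \<Lambda>)" "8 * B * (\<Lambda> / b\<^sup>2)"] pos by (simp add: \<tau>_def field_simps)
  have "0 < \<kappa>" using \<open>0 < \<tau>\<close> \<open>0 < s\<close> by (simp add: \<kappa>_def)
  define \<delta> where "\<delta> = min \<delta>1 (min \<delta>2 \<delta>3)"
  have "0 < \<delta>1" "0 < \<delta>2" "0 < \<delta>3"
    using pos \<open>0 < s\<close> \<open>0 < c1\<close> \<open>0 < \<tau>\<close> \<open>0 < \<kappa>\<close>
    by (auto simp: \<delta>1_def \<delta>2_def \<delta>3_def intro!: mult_pos_pos divide_pos_pos add_pos_pos)
  then have "0 < \<delta>" by (simp add: \<delta>_def)
  then show ?thesis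
  proof (rule that)
    fix h e f m :: "real \<Rightarrow> real"
    assume h: "h \<in> borel_measurable unit_time" "integrable unit_time (\<lambda>t. (h t)\<^sup>2)"
      and e: "integrable unit_time e" "\<And>t. 0 \<le> e t"
      and f: "f \<in> borel_measurable unit_time" "\<And>t. t \<in> {0..1} \<Longrightarrow> (f t)\<^sup>2 \<le> B * e t"
      and m: "continuous_on {0..1} m"
      and incr: "\<And>u v. 0 \<le> u \<Longrightarrow> u \<le> v \<Longrightarrow> v \<le> 1 \<Longrightarrow>
         \<bar>m v - m u\<bar> \<le> (\<integral>t. indicator {u<..<v} t * \<bar>h t\<bar> \<partial>unit_time)"
      and \<zeta>: "\<zeta> \<le> (\<integral>t. \<bar>f t\<bar> \<partial>unit_time)"
      and bound: "a\<^sup>2 * (\<integral>t. (h t)\<^sup>2 \<partial>unit_time) + b\<^sup>2 * (\<integral>t. e t \<partial>unit_time) \<le> \<Lambda>"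
    define X where "X = (\<integral>t. (h t)\<^sup>2 \<partial>unit_time)"
    define E where "E = (\<integral>t. e t \<partial>unit_time)"
    have mm: "m \<in> borel_measurable unit_time"
      using m by (intro continuous_imp_measurable_on_sets_lebesgue) auto
    have X0: "0 \<le> X" by (simp add: X_def)
    have "b\<^sup>2 * E \<le> \<Lambda>" using bound X0 mult_nonneg_nonneg[of "a\<^sup>2" X] unfolding X_def E_def
      by (smt (verit) zero_le_power2)
    then have E1: "E \<le> \<Lambda> / b\<^sup>2" using pos by (simp add: field_simps)
    obtain r where r: "r \<in> {0..1}" "\<And>t. t \<in> {0..1} \<Longrightarrow> m t \<le> m r"
      using continuous_attains_sup[OF _ _ m] by auto
    define L where "L = 2 * m r - m 0 - m 1"
    have L0: "0 \<le> L" using r(2)[of 0] r(2)[of 1] by (simp add: L_def)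
    have outer: "(\<bar>m u - m 0\<bar> + \<bar>m v - m 1\<bar>)\<^sup>2 \<le> (1 - (v - u)) * X"
      if "0 \<le> u" "u \<le> v" "v \<le> 1" for u v
      unfolding X_def by (rule outer_increments_le[OF h _ that]) (rule incr)
    have LX: "L\<^sup>2 \<le> X" unfolding L_def X_def by (rule max_increments_sq_le[OF h incr r])
    have Be: "0 \<le> B * e t" for t using e(2) pos by simp
    have f2: "integrable unit_time (\<lambda>t. (f t)\<^sup>2)"
      by (rule Bochner_Integration.integrable_bound[of _ "\<lambda>t. B * e t"])
        (use e f in \<open>auto simp: abs_of_nonneg[OF Be]\<close>)
    have EE: "E0 \<le> E"
    proof -
      have "\<zeta>\<^sup>2 \<le> (\<integral>t. \<bar>f t\<bar> \<partial>unit_time)\<^sup>2" using \<zeta> pos by (intro power_mono) auto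
      also have "\<dots> = (\<integral>t. indicator {0..1} t * \<bar>f t\<bar> \<partial>unit_time)\<^sup>2"
        by (intro arg_cong[of _ _ "\<lambda>x. x\<^sup>2"] Bochner_Integration.integral_cong) auto
      also have "\<dots> \<le> measure unit_time {0..1} * (\<integral>t. indicator {0..1} t * (f t)\<^sup>2 \<partial>unit_time)"
        by (rule finite_measure_Cauchy_Schwarz[OF finite_measure_unit_time _ f(1) f2]) (auto simp: sets_restrict_space_iff)
      also have "\<dots> = (\<integral>t. indicator {0..1} t * (f t)\<^sup>2 \<partial>unit_time)"
        by (subst measure_unit_time) (auto simp: sets_restrict_space_iff)
      also have "\<dots> \<le> (\<integral>t. B * e t \<partial>unit_time)"
        using e f by (intro integral_mono') (auto simp: indicator_def Be)
      also have "\<dots> = B * E" by (simp add: E_def)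
      finally show ?thesis using pos by (simp add: E0_def field_simps)
    qed
    show "\<exists>C. (\<forall>t\<in>{0..1}. m t \<le> C) \<and>
        a\<^sup>2 * (2 * C - m 0 - m 1)\<^sup>2 + b\<^sup>2 * (\<integral>t. e t / (1 + \<rho> * (C - m t)) \<partial>unit_time) + \<delta>
        \<le> a\<^sup>2 * (\<integral>t. (h t)\<^sup>2 \<partial>unit_time) + b\<^sup>2 * (\<integral>t. e t \<partial>unit_time)"
    proof (cases "L \<le> s")
      case True
      have "a\<^sup>2 * (2 * (m r + s) - m 0 - m 1)\<^sup>2 + b\<^sup>2 * (\<integral>t. e t / (1 + \<rho> * (m r + s - m t)) \<partial>unit_time)
          + s * (b\<^sup>2 * E0 * \<rho> / (1 + \<rho>)) / 2 \<le> a\<^sup>2 * X + b\<^sup>2 * (\<integral>t. e t \<partial>unit_time)"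
        by (rule small_shift_gain[OF \<open>0 < \<rho>\<close> \<open>0 < s\<close> \<open>s \<le> 1\<close> \<open>0 < E0\<close> _ e mm r(2)])
          (use s16 True LX EE in \<open>auto simp: L_def c1_def E_def\<close>)
      then show ?thesis using r(2) \<open>0 < s\<close>
        by (intro exI[of _ "m r + s"]) (force simp: X_def \<delta>_def \<delta>1_def c1_def)
    next
      case False
      define A where "A = {t \<in> {0..1}. \<tau> \<le> \<bar>t - r\<bar>}"
      have A: "A \<in> sets unit_time"
      proof -
        have "A = {0..1} - {r - \<tau><..<r + \<tau>}" by (auto simp: A_def)
        then show ?thesis by (auto simp: sets_restrict_space_iff)
      qed
      show ?thesis
      proof (cases "L\<^sup>2 + \<tau>\<^sup>2 * s\<^sup>2 / 4 \<le> X")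
        case True
        have "(\<integral>t. e t / (1 + \<rho> * (m r - m t)) \<partial>unit_time) \<le> E"
          using large_shift_gain[OF \<open>0 < \<rho>\<close> order_refl e mm r(2), of "{}"] r(2) by (simp add: E_def)
        then have "b\<^sup>2 * (\<integral>t. e t / (1 + \<rho> * (m r - m t)) \<partial>unit_time) \<le> b\<^sup>2 * E"
          by (intro mult_left_mono) auto
        moreover have "a\<^sup>2 * (L\<^sup>2 + \<tau>\<^sup>2 * s\<^sup>2 / 4) \<le> a\<^sup>2 * X"
          using True by (intro mult_left_mono) auto
        then have "a\<^sup>2 * L\<^sup>2 + \<delta>2 \<le> a\<^sup>2 * X" by (simp add: \<delta>2_def algebra_simps)
        ultimately show ?thesis using r(2)
          by (intro exI[of _ "m r"]) (auto simp: X_def E_def L_def \<delta>_def)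
      next
        case notX: False
        \<comment> \<open>Otherwise \<open>L (1 - \<tau> / 2)\<close> would be covered by the increments outside an interval of length \<open>\<tau>\<close>.
          Since \<open>(1 - \<tau> / 2)\<^sup>2 = 1 - \<tau> + \<tau>\<^sup>2 / 4\<close> exceeds \<open>1 - \<tau>\<close>, this contradicts the small defect
          \<open>\<integral> h\<^sup>2 < L\<^sup>2 + \<tau>\<^sup>2 s\<^sup>2 / 4\<close>.\<close>
        have far: "\<kappa> \<le> m r - m t" if "t \<in> A" for t
        proof (rule ccontr)
          assume *: "\<not> \<kappa> \<le> m r - m t"
          have t: "t \<in> {0..1}" "\<tau> \<le> \<bar>t - r\<bar>" using that by (auto simp: A_def)
          define u v where "u = min t r" and "v = max t r"
          have uv: "0 \<le> u" "u \<le> v" "v \<le> 1" "v - u = \<bar>t - r\<bar>" "m u + m v = m t + m r"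
            using t r(1) by (auto simp: u_def v_def min_def max_def)
          have "L * (1 - \<tau> / 2) = L - \<tau> * L / 2" by (simp add: algebra_simps)
          also have "\<dots> \<le> L - \<tau> * s / 2" using False \<open>0 < \<tau>\<close> by simp
          also have "\<dots> \<le> (m u - m 0) + (m v - m 1)" using * uv(5) by (simp add: L_def \<kappa>_def)
          finally have "(L * (1 - \<tau> / 2))\<^sup>2 \<le> (\<bar>m u - m 0\<bar> + \<bar>m v - m 1\<bar>)\<^sup>2"
            using L0 \<open>\<tau> < 1\<close> by (intro power_mono) auto
          also have "\<dots> \<le> (1 - (v - u)) * X" by (rule outer[OF uv(1-3)])
          also have "\<dots> \<le> (1 - \<tau>) * X" using uv(4) t(2) X0 by (intro mult_right_mono) auto
          also have "\<dots> \<le> (1 - \<tau>) * (L\<^sup>2 + \<tau>\<^sup>2 * s\<^sup>2 / 4)" using notX \<open>\<tau> < 1\<close> by (intro mult_left_mono) auto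
          also have "\<dots> < (1 - \<tau>) * L\<^sup>2 + \<tau>\<^sup>2 * s\<^sup>2 / 4"
            using \<open>0 < \<tau>\<close> \<open>0 < s\<close> by (simp add: algebra_simps)
          also have "\<dots> \<le> (1 - \<tau>) * L\<^sup>2 + \<tau>\<^sup>2 * L\<^sup>2 / 4"
            using False \<open>0 < s\<close> by (intro add_left_mono divide_right_mono mult_left_mono power_mono) auto
          also have "\<dots> = (L * (1 - \<tau> / 2))\<^sup>2" by (simp add: power2_eq_square field_simps)
          finally show False by simp
        qed
        have "\<zeta>\<^sup>2 / (4 * B) \<le> (\<integral>t. indicator A t * e t \<partial>unit_time)"
          unfolding A_def
          by (rule energy_outside_short_interval[OF \<open>0 < B\<close> \<open>0 < \<zeta>\<close> \<open>0 < \<tau>\<close> \<tau>8 e _ f \<zeta>]) (use E1 in \<open>simp add: E_def\<close>)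
        then have "\<rho> * \<kappa> / (1 + \<rho> * \<kappa>) * (\<zeta>\<^sup>2 / (4 * B))
            \<le> \<rho> * \<kappa> / (1 + \<rho> * \<kappa>) * (\<integral>t. indicator A t * e t \<partial>unit_time)"
          using \<open>0 < \<rho>\<close> \<open>0 < \<kappa>\<close> by (intro mult_left_mono) auto
        with large_shift_gain[OF \<open>0 < \<rho>\<close> less_imp_le[OF \<open>0 < \<kappa>\<close>] e mm r(2) A far]
        have "(\<integral>t. e t / (1 + \<rho> * (m r - m t)) \<partial>unit_time) + \<rho> * \<kappa> / (1 + \<rho> * \<kappa>) * (\<zeta>\<^sup>2 / (4 * B)) \<le> E"
          by (simp add: E_def)
        then have "b\<^sup>2 * ((\<integral>t. e t / (1 + \<rho> * (m r - m t)) \<partial>unit_time)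
            + \<rho> * \<kappa> / (1 + \<rho> * \<kappa>) * (\<zeta>\<^sup>2 / (4 * B))) \<le> b\<^sup>2 * E"
          by (intro mult_left_mono) auto
        then have "b\<^sup>2 * (\<integral>t. e t / (1 + \<rho> * (m r - m t)) \<partial>unit_time) + \<delta>3 \<le> b\<^sup>2 * E"
          by (simp add: \<delta>3_def distrib_left)
        moreover have "a\<^sup>2 * L\<^sup>2 \<le> a\<^sup>2 * X" using LX by (intro mult_left_mono) auto
        ultimately show ?thesis using r(2)
          by (intro exI[of _ "m r"]) (auto simp: X_def E_def L_def \<delta>_def)
      qed
    qed
  qed
qed

section \<open>Finite reversible Markov chains\<close>

lemma borel_measurable_vecI:
  fixes f :: "'s \<Rightarrow> 'a::euclidean_space ^ 'n"
  assumes "\<And>i. (\<lambda>t. f t $ i) \<in> borel_measurable M"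
  shows "f \<in> borel_measurable M"
proof (subst borel_measurable_euclidean_space, intro ballI)
  fix B :: "'a ^ 'n" assume "B \<in> Basis"
  then obtain i u where "B = axis i u" by (auto simp: Basis_vec_def)
  then show "(\<lambda>t. f t \<bullet> B) \<in> borel_measurable M"
    using assms[of i] by (simp add: inner_axis)
qed

lemma borel_measurable_vec_nth:
  fixes f :: "'s \<Rightarrow> 'a::euclidean_space ^ 'n"
  assumes "f \<in> borel_measurable M" shows "(\<lambda>t. f t $ i) \<in> borel_measurable M"
  by (rule borel_measurable_continuous_on[OF _ assms, of "\<lambda>v. v $ i"]) (intro continuous_intros)

definition total :: "('x::finite \<Rightarrow> real) \<Rightarrow> real ^ 'x \<Rightarrow> real" where
  "total \<pi> \<mu> = (\<Sum>x\<in>UNIV. \<mu> $ x * \<pi> x)"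

text \<open>The flux driven by the potential \<open>\<psi>\<close>; its action with respect to \<open>\<mu>\<close> itself is the kinetic energy
  defined next.\<close>

definition momentum :: "real ^ 'x \<Rightarrow> real ^ 'x \<Rightarrow> real ^ 'x ^ 'x" where
  "momentum \<psi> \<mu> = (\<chi> x y. (\<psi> $ y - \<psi> $ x) * log_mean (\<mu> $ x) (\<mu> $ y))"

definition energy :: "('x::finite \<Rightarrow> 'x \<Rightarrow> real) \<Rightarrow> ('x \<Rightarrow> real) \<Rightarrow> real ^ 'x \<Rightarrow> real ^ 'x \<Rightarrow> real" where
  "energy K \<pi> \<psi> \<mu> = 1 / 2 * (\<Sum>x\<in>UNIV. \<Sum>y\<in>UNIV.
     (\<psi> $ y - \<psi> $ x)\<^sup>2 * log_mean (\<mu> $ x) (\<mu> $ y) * K x y * \<pi> x)"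

lemma bounded_linear_total: "bounded_linear (total \<pi>)"
  unfolding total_def
  by (intro bounded_linear_sum bounded_linear_mult_const bounded_linear_vec_nth)

lemma total_simps:
  "total \<pi> (\<mu> + \<nu>) = total \<pi> \<mu> + total \<pi> \<nu>" "total \<pi> (\<mu> - \<nu>) = total \<pi> \<mu> - total \<pi> \<nu>"
  "total \<pi> (c *\<^sub>R \<mu>) = c * total \<pi> \<mu>"
  using bounded_linear_total[of \<pi>]
  by (auto dest: linear_simps)

lemma wnorm1_meas: "\<mu> \<in> meas \<Longrightarrow> wnorm1 \<pi> \<mu> = total \<pi> \<mu>"
  by (simp add: wnorm1_def total_def meas_def)

lemma divg_momentum:
  assumes "\<mu> \<in> meas"
  shows "divg K (momentum \<psi> \<mu>) $ x
    = (\<Sum>y\<in>UNIV. (\<psi> $ y - \<psi> $ x) * log_mean (\<mu> $ x) (\<mu> $ y) * K x y)"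
proof -
  have "(momentum \<psi> \<mu> $ x $ y - momentum \<psi> \<mu> $ y $ x) * K x y
      = 2 * ((\<psi> $ y - \<psi> $ x) * log_mean (\<mu> $ x) (\<mu> $ y) * K x y)" for y
    using assms log_mean_commute[of "\<mu> $ y" "\<mu> $ x"]
    by (simp add: momentum_def meas_def algebra_simps)
  note eq = this
  show ?thesis by (simp only: divg_def eq vec_lambda_beta sum_distrib_left[symmetric])
qed

lemma linear_divg: "linear (divg K)"
  by (rule linearI)
    (simp_all add: divg_def vec_eq_iff algebra_simps sum.distrib sum_subtractf sum_distrib_left)

locale shift_transport =
  fixes K :: "'x::finite \<Rightarrow> 'x \<Rightarrow> real" and \<pi> :: "'x \<Rightarrow> real"
    and p :: "real ^ 'x" and a b :: real
  assumes markov: "markov_kernel K" and irreducible: "irreducible_kernel K"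
    and invariant: "invariant_probability K \<pi>" and reversible: "reversible_kernel K \<pi>"
    and a_pos: "0 < a" and b_pos: "0 < b" and p_pos: "p \<in> pos_meas"
    and p_total: "(\<Sum>x\<in>UNIV. p $ x * \<pi> x) = 1"
begin

lemma K_nonneg: "0 \<le> K x y" and K_sum: "(\<Sum>y\<in>UNIV. K x y) = 1"
  using markov unfolding markov_kernel_def by blast+

lemma \<pi>_nonneg: "0 \<le> \<pi> x"
  using invariant unfolding invariant_probability_def by blast

lemma total_p: "total \<pi> p = 1" using p_total by (simp add: total_def)

text \<open>Positivity of \<open>\<pi>\<close> spreads along edges by invariance, and hence everywhere by irreducibility.\<close>

lemma \<pi>_pos: "0 < \<pi> x"
proof -
  have "\<exists>z. \<pi> z \<noteq> 0"
  proof (rule ccontr)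
    assume "\<not> ?thesis"
    then have "(\<Sum>x\<in>UNIV. \<pi> x) = 0" by simp
    moreover have "(\<Sum>x\<in>UNIV. \<pi> x) = 1" using invariant unfolding invariant_probability_def by blast
    ultimately show False by simp
  qed
  then obtain z where z: "0 < \<pi> z" using \<pi>_nonneg by (metis less_le)
  have "(z, x) \<in> {(u, v). K u v > 0}\<^sup>*" using irreducible by (simp add: irreducible_kernel_def)
  then show ?thesis
  proof (induction rule: rtrancl_induct)
    case (step u v)
    have "0 < \<pi> u * K u v" using step by simp
    also have "\<dots> \<le> (\<Sum>y\<in>UNIV. \<pi> y * K y v)"
      by (rule member_le_sum) (auto simp: \<pi>_nonneg K_nonneg)
    also have "\<dots> = \<pi> v" using invariant unfolding invariant_probability_def by metis
    finally show ?case .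
  qed (rule z)
qed

text \<open>By reversibility the weights \<open>K x y * \<pi> x\<close> are symmetric, while the integrand is antisymmetric.\<close>

lemma total_divg: "total \<pi> (divg K U) = 0"
proof -
  have sym: "K x y * \<pi> x = K y x * \<pi> y" for x y
    using reversible by (simp add: reversible_kernel_def)
  have "total \<pi> (divg K U) = 1 / 2 * (\<Sum>x\<in>UNIV. \<Sum>y\<in>UNIV. (U $ x $ y - U $ y $ x) * (K x y * \<pi> x))"
    by (simp add: total_def divg_def sum_distrib_left sum_distrib_right mult.assoc)
  also have "(\<Sum>x\<in>UNIV. \<Sum>y\<in>UNIV. (U $ x $ y - U $ y $ x) * (K x y * \<pi> x))
      = (\<Sum>x\<in>UNIV. \<Sum>y\<in>UNIV. U $ x $ y * (K x y * \<pi> x)) - (\<Sum>x\<in>UNIV. \<Sum>y\<in>UNIV. U $ y $ x * (K y x * \<pi> y))"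
    by (simp add: left_diff_distrib sum_subtractf sym)
  also have "\<dots> = 0" by (subst (2) sum.swap) simp
  finally show ?thesis by simp
qed

text \<open>A momentum supported on a single edge has a divergence proportional to the difference of the
  normalised point masses \<open>D u = \<delta>\<^sub>u / \<pi> u\<close> at its end points.  Summing along paths gives the
  differences for all pairs of points, and these span the functions of total mass zero.\<close>

lemma divg_surj:
  assumes "total \<pi> f = 0" shows "f \<in> range (divg K)"
proof -
  define R where "R = range (divg K)"
  have R: "subspace R" unfolding R_def by (rule linear_subspace_image[OF linear_divg subspace_UNIV])
  define D where "D x = axis x (1 / \<pi> x)" for x
  have edge: "D u - D v \<in> R" if "0 < K u v" "u \<noteq> v" for u v
  proof -
    define U :: "real ^ 'x ^ 'x" where "U = (\<chi> x y. if x = u \<and> y = v then 2 / (K u v * \<pi> u) else 0)"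
    have sym: "K v u = K u v * \<pi> u / \<pi> v"
      using reversible \<pi>_pos[of v] by (simp add: reversible_kernel_def field_simps)
    have "divg K U = D u - D v"
    proof (subst vec_eq_iff, intro allI)
      fix x
      have "divg K U $ x = 1 / 2 * (\<Sum>y\<in>UNIV. (if y = v then (if x = u then 2 / (K u v * \<pi> u) else 0) * K x y else 0)
           - (if y = u then (if x = v then 2 / (K u v * \<pi> u) else 0) * K x y else 0))"
        unfolding divg_def U_def vec_lambda_beta
        by (intro arg_cong[where f="\<lambda>s. 1/2 * s"] sum.cong refl) auto
      also have "\<dots> = 1 / 2 * ((if x = u then 2 / (K u v * \<pi> u) else 0) * K x v
          - (if x = v then 2 / (K u v * \<pi> u) else 0) * K x u)"
        by (simp add: sum_subtractf)
      also have "\<dots> = (D u - D v) $ x"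
        using that \<pi>_pos[of u] \<pi>_pos[of v] by (auto simp: D_def axis_def sym)
      finally show "divg K U $ x = (D u - D v) $ x" .
    qed
    then show ?thesis unfolding R_def by (metis rangeI)
  qed
  have path: "D x - D z \<in> R" for x z
  proof -
    have "(x, z) \<in> {(u, v). K u v > 0}\<^sup>*" using irreducible by (simp add: irreducible_kernel_def)
    then show ?thesis
    proof (induction rule: rtrancl_induct)
      case base show ?case using subspace_0[OF R] by simp
    next
      case (step u v)
      have "D u - D v \<in> R" using edge[of u v] step(2) subspace_0[OF R] by (cases "u = v") auto
      from subspace_add[OF R step.IH this] show ?case by simp
    qed
  qed
  define z :: 'x where "z = undefined"
  have "f = (\<Sum>x\<in>UNIV. (f $ x * \<pi> x) *\<^sub>R (D x - D z))"
  proof -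
    have "(\<Sum>x\<in>UNIV. (f $ x * \<pi> x) *\<^sub>R (D x - D z))
        = (\<Sum>x\<in>UNIV. (f $ x * \<pi> x) *\<^sub>R D x) - total \<pi> f *\<^sub>R D z"
      by (simp add: scaleR_diff_right sum_subtractf total_def scaleR_left.sum)
    also have "\<dots> = (\<Sum>x\<in>UNIV. (f $ x * \<pi> x) *\<^sub>R D x)" using assms by simp
    also have "\<dots> = f"
    proof (subst vec_eq_iff, intro allI)
      fix y
      have "(\<Sum>x\<in>UNIV. (f $ x * \<pi> x) *\<^sub>R D x) $ y = (\<Sum>x\<in>UNIV. if x = y then f $ x * \<pi> x * (1 / \<pi> x) else 0)"
        unfolding sum_component by (intro sum.cong) (auto simp: D_def axis_def)
      also have "\<dots> = f $ y" using \<pi>_pos[of y] by simp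
      finally show "(\<Sum>x\<in>UNIV. (f $ x * \<pi> x) *\<^sub>R D x) $ y = f $ y" .
    qed
    finally show ?thesis by simp
  qed
  also have "\<dots> \<in> R" using path by (intro subspace_sum[OF R] subspace_scale[OF R])
  finally show ?thesis by (simp add: R_def)
qed

text \<open>The estimate \<open>action_dens_expand\<close>, summed over all edges.\<close>

lemma action'_momentum_le:
  assumes "\<mu> \<in> meas" "0 \<le> q" "\<And>x. (1 + q) * \<mu> $ x \<le> \<nu> $ x"
  shows "action' K \<pi> \<nu> (momentum \<psi> \<mu>) \<le> ennreal (energy K \<pi> \<psi> \<mu> / (1 + q))"
proof -
  have nn: "0 \<le> \<mu> $ x" for x using assms(1) by (simp add: meas_def)
  define g where "g x y = (\<psi> $ y - \<psi> $ x)\<^sup>2 * log_mean (\<mu> $ x) (\<mu> $ y) / (1 + q) * (K x y * \<pi> x)" for x y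
  have g: "0 \<le> g x y" for x y
    using assms(2) by (auto simp: g_def log_mean_nonneg K_nonneg \<pi>_nonneg)
  have "action_dens (momentum \<psi> \<mu> $ x $ y) (\<nu> $ x) (\<nu> $ y) * ennreal (K x y * \<pi> x) \<le> ennreal (g x y)" for x y
  proof -
    have "action_dens (momentum \<psi> \<mu> $ x $ y) (\<nu> $ x) (\<nu> $ y) * ennreal (K x y * \<pi> x)
        \<le> ennreal ((\<psi> $ y - \<psi> $ x)\<^sup>2 * log_mean (\<mu> $ x) (\<mu> $ y) / (1 + q)) * ennreal (K x y * \<pi> x)"
      using action_dens_expand[OF nn nn assms(2,3,3), where w = "\<psi> $ y - \<psi> $ x"]
      by (intro mult_right_mono) (auto simp: momentum_def)
    also have "\<dots> = ennreal (g x y)"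
      using assms(2) by (subst ennreal_mult[symmetric]) (auto simp: g_def log_mean_nonneg K_nonneg \<pi>_nonneg)
    finally show ?thesis .
  qed
  then have "action' K \<pi> \<nu> (momentum \<psi> \<mu>) \<le> (\<Sum>x\<in>UNIV. \<Sum>y\<in>UNIV. ennreal (g x y)) / 2"
    unfolding action'_def by (intro divide_right_mono_ennreal sum_mono) auto
  also have "\<dots> = ennreal ((\<Sum>x\<in>UNIV. \<Sum>y\<in>UNIV. g x y) / 2)"
    using g by (simp add: sum_ennreal sum_nonneg ennreal_divide_numeral)
  also have "(\<Sum>x\<in>UNIV. \<Sum>y\<in>UNIV. g x y) / 2 = energy K \<pi> \<psi> \<mu> / (1 + q)"
    by (simp add: g_def energy_def sum_divide_distrib sum_distrib_left sum_distrib_right mult.assoc field_simps)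
  finally show ?thesis .
qed

lemma energy_nonneg: "0 \<le> energy K \<pi> \<psi> \<mu>"
  unfolding energy_def by (auto intro!: sum_nonneg simp: log_mean_nonneg K_nonneg \<pi>_nonneg)

text \<open>The velocity of a coordinate is controlled by the energy: Cauchy-Schwarz for the weights
  \<open>\<theta>(\<mu> x, \<mu> y) K x y\<close>, whose sum over \<open>y\<close> is at most \<open>M\<close>.\<close>

lemma divg_momentum_sq_le:
  assumes "\<mu> \<in> meas" "\<And>y. \<mu> $ y \<le> M"
  shows "(divg K (momentum \<psi> \<mu>) $ x)\<^sup>2 \<le> 2 * M / \<pi> x * energy K \<pi> \<psi> \<mu>"
proof -
  have nn: "0 \<le> \<mu> $ y" for y using assms(1) by (simp add: meas_def)
  define \<theta> where "\<theta> y = log_mean (\<mu> $ x) (\<mu> $ y)" for y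
  define w where "w y = \<psi> $ y - \<psi> $ x" for y
  have \<theta>: "0 \<le> \<theta> y" "\<theta> y \<le> M" for y
    using nn assms(2) by (auto simp: \<theta>_def log_mean_nonneg log_mean_le)
  define S where "S = (\<Sum>y\<in>UNIV. (w y)\<^sup>2 * \<theta> y * K x y)"
  have S0: "0 \<le> S" using \<theta> by (auto simp: S_def K_nonneg intro!: sum_nonneg)
  have sq: "sqrt (\<theta> y * K x y) * sqrt (\<theta> y * K x y) = \<theta> y * K x y" for y
    using \<theta>[of y] K_nonneg by simp
  have "divg K (momentum \<psi> \<mu>) $ x = (\<Sum>y\<in>UNIV. (w y * sqrt (\<theta> y * K x y)) * sqrt (\<theta> y * K x y))"
    unfolding divg_momentum[OF assms(1)] by (simp only: mult.assoc sq) (simp add: w_def \<theta>_def)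
  then have "(divg K (momentum \<psi> \<mu>) $ x)\<^sup>2
      \<le> (\<Sum>y\<in>UNIV. (w y * sqrt (\<theta> y * K x y))\<^sup>2) * (\<Sum>y\<in>UNIV. (sqrt (\<theta> y * K x y))\<^sup>2)"
    by (simp only: Cauchy_Schwarz_ineq_sum)
  also have "\<dots> = S * (\<Sum>y\<in>UNIV. \<theta> y * K x y)"
    using \<theta> K_nonneg by (simp add: S_def power_mult_distrib mult.assoc)
  also have "\<dots> \<le> S * (\<Sum>y\<in>UNIV. M * K x y)"
    using S0 \<theta> K_nonneg by (intro mult_left_mono sum_mono mult_right_mono) auto
  also have "\<dots> = M * S" by (simp add: sum_distrib_left[symmetric] K_sum)
  also have "\<dots> \<le> M * (2 * energy K \<pi> \<psi> \<mu> / \<pi> x)"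
  proof (rule mult_left_mono)
    have "S * \<pi> x = (\<Sum>y\<in>UNIV. (w y)\<^sup>2 * \<theta> y * K x y * \<pi> x)" by (simp add: S_def sum_distrib_right)
    also have "\<dots> \<le> (\<Sum>x\<in>UNIV. \<Sum>y\<in>UNIV. (\<psi> $ y - \<psi> $ x)\<^sup>2 * log_mean (\<mu> $ x) (\<mu> $ y) * K x y * \<pi> x)"
      unfolding w_def \<theta>_def
      by (rule member_le_sum[of x UNIV "\<lambda>x. \<Sum>y\<in>UNIV. (\<psi> $ y - \<psi> $ x)\<^sup>2 * log_mean (\<mu> $ x) (\<mu> $ y) * K x y * \<pi> x"])
        (auto intro!: sum_nonneg simp: log_mean_nonneg K_nonneg \<pi>_nonneg)
    also have "\<dots> = 2 * energy K \<pi> \<psi> \<mu>" by (simp add: energy_def)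
    finally show "S \<le> 2 * energy K \<pi> \<psi> \<mu> / \<pi> x" using \<pi>_pos[of x] by (simp add: field_simps)
    show "0 \<le> M" using \<theta>[of x] by simp
  qed
  finally show ?thesis by (simp add: mult_ac)
qed

section \<open>Curves for the transport metric\<close>

text \<open>The evolution equation in divergence form; for nonnegative densities the momentum is antisymmetric,
  so that the two forms agree.\<close>

lemma W_curvesD:
  assumes "(\<mu>, \<psi>, h) \<in> W_curves K p \<mu>0 \<mu>1"
  shows "t \<in> {0..1} \<Longrightarrow> \<mu> t \<in> meas" "abs_cont_curve 0 1 \<mu>" "\<mu> 0 = \<mu>0" "\<mu> 1 = \<mu>1"
    "\<psi> \<in> borel_measurable unit_time" "h \<in> borel_measurable unit_time"
    "AE t in unit_time. \<exists>d. (\<mu> has_vector_derivative d) (at t within {0..1})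
        \<and> d + divg K (momentum (\<psi> t) (\<mu> t)) = h t *\<^sub>R p"
proof -
  have ae: "AE t in unit_time. \<exists>d. (\<mu> has_vector_derivative d) (at t within {0..1})
              \<and> (\<forall>x. d $ x + (\<Sum>y\<in>UNIV. (\<psi> t $ y - \<psi> t $ x)
                                   * log_mean (\<mu> t $ x) (\<mu> t $ y) * K x y)
                     = h t * p $ x)"
    and meas: "\<And>t. t \<in> {0..1} \<Longrightarrow> \<mu> t \<in> meas"
    using assms unfolding W_curves_def by auto
  show "AE t in unit_time. \<exists>d. (\<mu> has_vector_derivative d) (at t within {0..1})
        \<and> d + divg K (momentum (\<psi> t) (\<mu> t)) = h t *\<^sub>R p"
    using ae AE_space
  proof eventually_elim
    case (elim t)
    then have "\<mu> t \<in> meas" using meas by simp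
    with elim(1) show ?case by (simp add: vec_eq_iff divg_momentum)
  qed
qed (use assms in \<open>auto simp: W_curves_def\<close>)

lemma W_curves_measurable:
  assumes W: "(\<mu>, \<psi>, h) \<in> W_curves K p \<mu>0 \<mu>1"
  shows "(\<lambda>t. momentum (\<psi> t) (\<mu> t)) \<in> borel_measurable unit_time"
    and "(\<lambda>t. energy K \<pi> (\<psi> t) (\<mu> t)) \<in> borel_measurable unit_time"
    and "(\<lambda>t. divg K (momentum (\<psi> t) (\<mu> t)) $ x) \<in> borel_measurable unit_time"
proof -
  have "\<mu> \<in> borel_measurable unit_time"
    using abs_cont_curve_imp_continuous_on[OF W_curvesD(2)[OF W]]
    by (intro continuous_imp_measurable_on_sets_lebesgue) auto
  then have \<mu>m: "(\<lambda>t. \<mu> t $ x) \<in> borel_measurable unit_time" for x by (rule borel_measurable_vec_nth)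
  have [measurable]: "(\<lambda>t. \<psi> t $ x) \<in> borel_measurable unit_time" for x
    using W_curvesD(5)[OF W] by (rule borel_measurable_vec_nth)
  have [measurable]: "(\<lambda>t. log_mean (\<mu> t $ x) (\<mu> t $ y)) \<in> borel_measurable unit_time" for x y
    using W_curvesD(1)[OF W] by (intro borel_measurable_log_mean \<mu>m) (auto simp: meas_def)
  have mom: "(\<lambda>t. momentum (\<psi> t) (\<mu> t) $ x $ y) \<in> borel_measurable unit_time" for x y
    unfolding momentum_def vec_lambda_beta by measurable
  show "(\<lambda>t. momentum (\<psi> t) (\<mu> t)) \<in> borel_measurable unit_time"
    by (intro borel_measurable_vecI mom)
  show "(\<lambda>t. energy K \<pi> (\<psi> t) (\<mu> t)) \<in> borel_measurable unit_time"
    unfolding energy_def by measurable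
  note [measurable] = mom
  show "(\<lambda>t. divg K (momentum (\<psi> t) (\<mu> t)) $ x) \<in> borel_measurable unit_time"
    unfolding divg_def vec_lambda_beta by measurable
qed

text \<open>The projection along \<open>p\<close> onto the functions of total mass zero.  Applied to a curve it removes the
  effect of the shifts, so that its derivative is minus the divergence of the momentum.\<close>

definition transport_part :: "real ^ 'x \<Rightarrow> real ^ 'x" where
  "transport_part \<mu> = \<mu> - total \<pi> \<mu> *\<^sub>R p"

lemma bounded_linear_transport_part: "bounded_linear transport_part"
  unfolding transport_part_def
  by (intro bounded_linear_sub bounded_linear_ident bounded_linear_scaleR_const bounded_linear_total)

lemma W_curves_derivatives:
  assumes W: "(\<mu>, \<psi>, h) \<in> W_curves K p \<mu>0 \<mu>1"
  shows "AE t in unit_time. ((\<lambda>t. total \<pi> (\<mu> t)) has_vector_derivative h t) (at t within {0..1})"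
    and "AE t in unit_time. ((\<lambda>t. transport_part (\<mu> t)) has_vector_derivative
        - divg K (momentum (\<psi> t) (\<mu> t))) (at t within {0..1})"
proof -
  have *: "((\<lambda>t. total \<pi> (\<mu> t)) has_vector_derivative h t) (at t within {0..1}) \<and>
      ((\<lambda>t. transport_part (\<mu> t)) has_vector_derivative
        - divg K (momentum (\<psi> t) (\<mu> t))) (at t within {0..1})"
    if d: "(\<mu> has_vector_derivative d) (at t within {0..1})"
      and eq: "d + divg K (momentum (\<psi> t) (\<mu> t)) = h t *\<^sub>R p" for t d
  proof
    have deq: "d = h t *\<^sub>R p - divg K (momentum (\<psi> t) (\<mu> t))" using eq by (simp add: eq_diff_eq)
    have td: "total \<pi> d = h t" unfolding deq by (simp add: total_simps total_p total_divg)
    show "((\<lambda>t. total \<pi> (\<mu> t)) has_vector_derivative h t) (at t within {0..1})"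
      using bounded_linear.has_vector_derivative[OF bounded_linear_total[of \<pi>] d] by (simp add: td)
    have "transport_part d = - divg K (momentum (\<psi> t) (\<mu> t))"
      by (simp add: transport_part_def td) (simp add: deq)
    then show "((\<lambda>t. transport_part (\<mu> t)) has_vector_derivative
        - divg K (momentum (\<psi> t) (\<mu> t))) (at t within {0..1})"
      using bounded_linear.has_vector_derivative[OF bounded_linear_transport_part d] by simp
  qed
  show "AE t in unit_time. ((\<lambda>t. total \<pi> (\<mu> t)) has_vector_derivative h t) (at t within {0..1})"
    using W_curvesD(7)[OF W] by eventually_elim (use * in blast)
  show "AE t in unit_time. ((\<lambda>t. transport_part (\<mu> t)) has_vector_derivative
        - divg K (momentum (\<psi> t) (\<mu> t))) (at t within {0..1})"
    using W_curvesD(7)[OF W] by eventually_elim (use * in blast)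
qed

lemma W_cost_energy:
  "W_cost K \<pi> a b \<mu> \<psi> h = ennreal (a\<^sup>2) * (\<integral>\<^sup>+ t. ennreal ((h t)\<^sup>2) \<partial>unit_time)
    + ennreal (b\<^sup>2) * (\<integral>\<^sup>+ t. ennreal (energy K \<pi> (\<psi> t) (\<mu> t)) \<partial>unit_time)"
  by (simp add: W_cost_def energy_def)

lemma W_cost_finite:
  assumes W: "(\<mu>, \<psi>, h) \<in> W_curves K p \<mu>0 \<mu>1" and fin: "W_cost K \<pi> a b \<mu> \<psi> h < \<infinity>"
  shows "integrable unit_time (\<lambda>t. (h t)\<^sup>2)"
    and "integrable unit_time (\<lambda>t. energy K \<pi> (\<psi> t) (\<mu> t))"
    and "W_cost K \<pi> a b \<mu> \<psi> h = ennreal (a\<^sup>2 * (\<integral>t. (h t)\<^sup>2 \<partial>unit_time)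
        + b\<^sup>2 * (\<integral>t. energy K \<pi> (\<psi> t) (\<mu> t) \<partial>unit_time))"
proof -
  note [measurable] = W_curvesD(6)[OF W] W_curves_measurable(2)[OF W]
  have fins: "(\<integral>\<^sup>+ t. ennreal ((h t)\<^sup>2) \<partial>unit_time) < \<infinity>"
    "(\<integral>\<^sup>+ t. ennreal (energy K \<pi> (\<psi> t) (\<mu> t)) \<partial>unit_time) < \<infinity>"
    using fin a_pos b_pos by (auto simp: W_cost_energy ennreal_mult_less_top)
  show h: "integrable unit_time (\<lambda>t. (h t)\<^sup>2)"
    by (rule integrableI_nonneg) (use fins in auto)
  show e: "integrable unit_time (\<lambda>t. energy K \<pi> (\<psi> t) (\<mu> t))"
    by (rule integrableI_nonneg) (use fins energy_nonneg in auto)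
  show "W_cost K \<pi> a b \<mu> \<psi> h = ennreal (a\<^sup>2 * (\<integral>t. (h t)\<^sup>2 \<partial>unit_time)
        + b\<^sup>2 * (\<integral>t. energy K \<pi> (\<psi> t) (\<mu> t) \<partial>unit_time))"
    unfolding W_cost_energy
    by (subst (1 2) nn_integral_eq_integral)
      (use h e energy_nonneg in \<open>auto simp: ennreal_plus integral_nonneg simp flip: ennreal_mult\<close>)
qed

lemma total_increment_le:
  assumes W: "(\<mu>, \<psi>, h) \<in> W_curves K p \<mu>0 \<mu>1" and sq: "integrable unit_time (\<lambda>t. (h t)\<^sup>2)"
    and uv: "0 \<le> u" "u \<le> v" "v \<le> 1"
  shows "\<bar>total \<pi> (\<mu> v) - total \<pi> (\<mu> u)\<bar> \<le> (\<integral>t. indicator {u<..<v} t * \<bar>h t\<bar> \<partial>unit_time)"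
proof (rule abs_cont_increment_le[OF _ W_curves_derivatives(1)[OF W] _ uv])
  show "abs_cont_curve 0 1 (\<lambda>t. total \<pi> (\<mu> t))"
    using abs_cont_curve_bounded_linear[OF W_curvesD(2)[OF W] bounded_linear_total, of \<pi> 0] by simp
  have "integrable unit_time (\<lambda>t. \<bar>h t\<bar>)"
    by (rule finite_measure_Cauchy_Schwarz(1)[OF finite_measure_unit_time sets.empty_sets W_curvesD(6)[OF W] sq])
  then show "integrable unit_time h"
    using integrable_abs_iff[OF W_curvesD(6)[OF W]] by simp
qed

section \<open>Competitors for the shift-transport metric\<close>

text \<open>Squares avoid the square root inside the infimum, and make the competitors of the two metrics
  comparable.\<close>

lemma D_dist_sq_le:
  assumes "(H0, H1, \<nu>, U) \<in> ST K \<pi> p \<mu>0 \<mu>1"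
  shows "(D_dist K \<pi> p a b \<mu>0 \<mu>1)\<^sup>2 \<le> ennreal (a\<^sup>2 * (\<bar>H0\<bar> + \<bar>H1\<bar>)\<^sup>2)
      + ennreal (b\<^sup>2) * (\<integral>\<^sup>+ t. action' K \<pi> (\<nu> t) (U t) \<partial>unit_time)" (is "_ \<le> ?c")
proof -
  have "D_dist K \<pi> p a b \<mu>0 \<mu>1 \<le> esqrt ?c"
    unfolding D_dist_def by (rule INF_lower2[OF assms]) simp
  then have "(D_dist K \<pi> p a b \<mu>0 \<mu>1)\<^sup>2 \<le> (esqrt ?c)\<^sup>2" by (rule power_mono) simp
  then show ?thesis by (simp add: esqrt_power2)
qed

text \<open>Shifts by \<open>1 + total \<pi> \<mu>1\<close> and \<open>1 + total \<pi> \<mu>0\<close> make the total masses equal and both densities at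
  least \<open>p\<close>.  Along the straight line between them all logarithmic means stay above \<open>q = min p\<close>, so
  that a constant momentum has bounded action.\<close>

lemma D_dist_finite:
  assumes "\<mu>0 \<in> meas" "\<mu>1 \<in> meas"
  shows "D_dist K \<pi> p a b \<mu>0 \<mu>1 < \<infinity>"
proof -
  have tnn: "0 \<le> total \<pi> \<mu>" if "\<mu> \<in> meas" for \<mu>
    using that by (auto simp: total_def meas_def \<pi>_nonneg intro!: sum_nonneg)
  define H0 H1 where "H0 = 1 + total \<pi> \<mu>1" and "H1 = 1 + total \<pi> \<mu>0"
  have H: "1 \<le> H0" "1 \<le> H1" using assms tnn by (auto simp: H0_def H1_def)
  define \<nu>0 \<nu>1 where "\<nu>0 = \<mu>0 + H0 *\<^sub>R p" and "\<nu>1 = \<mu>1 + H1 *\<^sub>R p"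
  define \<nu> where "\<nu> t = \<nu>0 + t *\<^sub>R (\<nu>1 - \<nu>0)" for t :: real
  define q where "q = Min (range (\<lambda>x. p $ x))"
  have q: "0 < q" "q \<le> p $ x" for x
    using p_pos by (auto simp: q_def pos_meas_def)
  have ge: "q \<le> \<nu>0 $ x" "q \<le> \<nu>1 $ x" for x
  proof -
    have "p $ x \<le> H0 * p $ x" "p $ x \<le> H1 * p $ x"
      using H p_pos by (auto simp: pos_meas_def)
    then show "q \<le> \<nu>0 $ x" "q \<le> \<nu>1 $ x"
      using q(2)[of x] assms by (auto simp: \<nu>0_def \<nu>1_def meas_def intro: add_nonneg_nonneg order_trans add_increasing)
  qed
  have \<nu>ge: "q \<le> \<nu> t $ x" if "t \<in> {0..1}" for t x
  proof -
    have "q = (1 - t) * q + t * q" by (simp add: algebra_simps)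
    also have "\<dots> \<le> (1 - t) * \<nu>0 $ x + t * \<nu>1 $ x"
      using that ge by (intro add_mono mult_left_mono) auto
    also have "\<dots> = \<nu> t $ x" by (simp add: \<nu>_def algebra_simps)
    finally show ?thesis .
  qed
  have "total \<pi> (\<nu>0 - \<nu>1) = 0"
    by (simp add: \<nu>0_def \<nu>1_def total_simps total_p H0_def H1_def)
  then obtain U where U: "divg K U = \<nu>0 - \<nu>1" using divg_surj by (metis rangeE)
  have deriv: "(\<nu> has_vector_derivative \<nu>1 - \<nu>0) (at t within {0..1})" for t
    unfolding \<nu>_def by (auto intro!: derivative_eq_intros)
  have "abs_cont_curve 0 1 (\<lambda>t. t *\<^sub>R (\<nu>1 - \<nu>0) + \<nu>0)"
    by (rule abs_cont_curve_bounded_linear[OF abs_cont_curve_ident bounded_linear_scaleR_left])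
  then have ac: "abs_cont_curve 0 1 \<nu>" by (simp add: \<nu>_def[abs_def] add.commute)
  have pos: "x \<in> meas" if "\<And>i. q \<le> x $ i" for x :: "real ^ 'x"
    using that q(1) by (auto simp: meas_def intro: order_trans less_imp_le)
  have ST: "(H0, H1, \<nu>, \<lambda>_. U) \<in> ST K \<pi> p \<mu>0 \<mu>1"
    unfolding ST_def mem_Collect_eq prod.case
  proof (intro conjI ballI)
    show "\<mu>0 + H0 *\<^sub>R p \<in> meas" "\<mu>1 + H1 *\<^sub>R p \<in> meas"
      using pos[of \<nu>0] pos[of \<nu>1] ge by (auto simp: \<nu>0_def \<nu>1_def)
    show "wnorm1 \<pi> \<mu>0 + H0 = wnorm1 \<pi> \<mu>1 + H1" using assms by (simp add: wnorm1_meas H0_def H1_def)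
    show "AE t in unit_time. \<exists>d. (\<nu> has_vector_derivative d) (at t within {0..1}) \<and> d + divg K U = 0"
      using deriv U by (intro always_eventually allI exI[of _ "\<nu>1 - \<nu>0"]) auto
    show "\<nu> t \<in> meas" if "t \<in> {0..1}" for t using \<nu>ge[OF that] by (rule pos)
  qed (use ac in \<open>auto simp: \<nu>_def \<nu>0_def \<nu>1_def\<close>)
  define S where "S = ennreal ((\<Sum>x\<in>UNIV. \<Sum>y\<in>UNIV. (U $ x $ y)\<^sup>2 / q * (K x y * \<pi> x)) / 2)"
  have "action' K \<pi> (\<nu> t) U \<le> S" if t: "t \<in> {0..1}" for t
  proof -
    have "action' K \<pi> (\<nu> t) U
        \<le> (\<Sum>x\<in>UNIV. \<Sum>y\<in>UNIV. ennreal ((U $ x $ y)\<^sup>2 / q) * ennreal (K x y * \<pi> x)) / 2"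
      unfolding action'_def
    proof (intro divide_right_mono_ennreal sum_mono mult_right_mono)
      fix x y
      have "q \<le> log_mean (\<nu> t $ x) (\<nu> t $ y)" using \<nu>ge[OF t] q(1) by (intro log_mean_ge) auto
      then show "action_dens (U $ x $ y) (\<nu> t $ x) (\<nu> t $ y) \<le> ennreal ((U $ x $ y)\<^sup>2 / q)"
        using q(1) by (subst action_dens_pos) (auto intro!: ennreal_leI divide_left_mono)
    qed simp
    also have "\<dots> = S"
      using q(1) by (simp add: S_def sum_ennreal sum_nonneg ennreal_divide_numeral K_nonneg \<pi>_nonneg
          flip: ennreal_mult)
    finally show ?thesis .
  qed
  then have "(\<integral>\<^sup>+ t. action' K \<pi> (\<nu> t) U \<partial>unit_time) \<le> (\<integral>\<^sup>+ t. S \<partial>unit_time)"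
    by (intro nn_integral_mono) auto
  also have "\<dots> = S" by (simp add: emeasure_restrict_space)
  finally have "(\<integral>\<^sup>+ t. action' K \<pi> (\<nu> t) U \<partial>unit_time) \<le> S" .
  then have "(D_dist K \<pi> p a b \<mu>0 \<mu>1)\<^sup>2 \<le> ennreal (a\<^sup>2 * (\<bar>H0\<bar> + \<bar>H1\<bar>)\<^sup>2) + ennreal (b\<^sup>2) * S"
    by (intro order_trans[OF D_dist_sq_le[OF ST]] add_left_mono mult_left_mono) auto
  also have "\<dots> < \<infinity>"
    by (simp add: S_def ennreal_mult_less_top)
  finally show ?thesis by (auto simp: power_less_top_ennreal)
qed

text \<open>The basic construction: \<open>transport_part (\<mu> t) + C p = \<mu> t + (C - m t) p\<close>, where \<open>m\<close> is the total mass
  of \<open>\<mu>\<close> and \<open>C\<close> an upper bound of it.  The original momentum is kept.\<close>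

lemma shifted_curve_in_ST:
  assumes W: "(\<mu>, \<psi>, h) \<in> W_curves K p \<mu>0 \<mu>1"
    and C: "\<And>t. t \<in> {0..1} \<Longrightarrow> total \<pi> (\<mu> t) \<le> C"
  shows "(C - total \<pi> \<mu>0, C - total \<pi> \<mu>1, \<lambda>t. transport_part (\<mu> t) + C *\<^sub>R p,
      \<lambda>t. momentum (\<psi> t) (\<mu> t)) \<in> ST K \<pi> p \<mu>0 \<mu>1"
proof -
  note [simp] = W_curvesD(3,4)[OF W]
  have shift: "transport_part \<mu>' + C *\<^sub>R p = \<mu>' + (C - total \<pi> \<mu>') *\<^sub>R p" for \<mu>'
    by (simp add: transport_part_def scaleR_diff_left)
  have meas: "transport_part (\<mu> t) + C *\<^sub>R p \<in> meas" if "t \<in> {0..1}" for t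
    using W_curvesD(1)[OF W that] C[OF that] p_pos less_imp_le[of 0 "p $ _"]
    by (auto simp: shift meas_def pos_meas_def intro!: add_nonneg_nonneg mult_nonneg_nonneg)
  have ends: "\<mu>0 \<in> meas" "\<mu>1 \<in> meas" using W_curvesD(1)[OF W, of 0] W_curvesD(1)[OF W, of 1] by auto
  show ?thesis
    unfolding ST_def mem_Collect_eq prod.case
  proof (intro conjI ballI)
    show "\<mu>0 + (C - total \<pi> \<mu>0) *\<^sub>R p \<in> meas" "\<mu>1 + (C - total \<pi> \<mu>1) *\<^sub>R p \<in> meas"
      using meas[of 0] meas[of 1] by (simp_all add: shift)
    show "wnorm1 \<pi> \<mu>0 + (C - total \<pi> \<mu>0) = wnorm1 \<pi> \<mu>1 + (C - total \<pi> \<mu>1)"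
      using ends by (simp add: wnorm1_meas)
    show "AE t in unit_time. \<exists>d. ((\<lambda>t. transport_part (\<mu> t) + C *\<^sub>R p) has_vector_derivative d) (at t within {0..1})
        \<and> d + divg K (momentum (\<psi> t) (\<mu> t)) = 0"
      using W_curves_derivatives(2)[OF W]
      by eventually_elim (auto intro!: exI has_vector_derivative_add_const[THEN iffD2])
    show "abs_cont_curve 0 1 (\<lambda>t. transport_part (\<mu> t) + C *\<^sub>R p)"
      by (rule abs_cont_curve_bounded_linear[OF W_curvesD(2)[OF W] bounded_linear_transport_part])
  qed (use meas W_curves_measurable(1)[OF W] in \<open>auto simp: shift\<close>)
qed

text \<open>The factor by which the densities grow comes from
  \<open>\<mu> + (C - m) p \<ge> (1 + \<rho> (C - m)) \<mu>\<close>.  With \<open>\<rho> = 0\<close> this is the comparison with the unshifted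
  energy.\<close>

lemma D_dist_sq_le_shifted:
  assumes W: "(\<mu>, \<psi>, h) \<in> W_curves K p \<mu>0 \<mu>1"
    and C: "\<And>t. t \<in> {0..1} \<Longrightarrow> total \<pi> (\<mu> t) \<le> C"
    and \<rho>: "0 \<le> \<rho>" "\<And>t x. t \<in> {0..1} \<Longrightarrow> \<rho> * \<mu> t $ x \<le> p $ x"
  shows "(D_dist K \<pi> p a b \<mu>0 \<mu>1)\<^sup>2 \<le> ennreal (a\<^sup>2 * (2 * C - total \<pi> \<mu>0 - total \<pi> \<mu>1)\<^sup>2)
      + ennreal (b\<^sup>2) * (\<integral>\<^sup>+ t. ennreal (energy K \<pi> (\<psi> t) (\<mu> t) / (1 + \<rho> * (C - total \<pi> (\<mu> t)))) \<partial>unit_time)"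
proof -
  have H: "\<bar>C - total \<pi> \<mu>0\<bar> + \<bar>C - total \<pi> \<mu>1\<bar> = 2 * C - total \<pi> \<mu>0 - total \<pi> \<mu>1"
    using C[of 0] C[of 1] W_curvesD(3,4)[OF W] by simp
  have act: "action' K \<pi> (transport_part (\<mu> t) + C *\<^sub>R p) (momentum (\<psi> t) (\<mu> t))
      \<le> ennreal (energy K \<pi> (\<psi> t) (\<mu> t) / (1 + \<rho> * (C - total \<pi> (\<mu> t))))" if t: "t \<in> {0..1}" for t
  proof (rule action'_momentum_le)
    show "\<mu> t \<in> meas" by (rule W_curvesD(1)[OF W t])
    show "0 \<le> \<rho> * (C - total \<pi> (\<mu> t))" using C[OF t] \<rho>(1) by simp
    show "(1 + \<rho> * (C - total \<pi> (\<mu> t))) * \<mu> t $ x \<le> (transport_part (\<mu> t) + C *\<^sub>R p) $ x" for x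
      using mult_left_mono[OF \<rho>(2)[OF t, of x], of "C - total \<pi> (\<mu> t)"] C[OF t]
      by (simp add: transport_part_def algebra_simps)
  qed
  show ?thesis
    using D_dist_sq_le[OF shifted_curve_in_ST[OF W C], unfolded H]
    by (rule order_trans) (auto intro!: add_left_mono mult_left_mono nn_integral_mono act)
qed

lemma D_dist_sq_le_W_cost:
  assumes W: "(\<mu>, \<psi>, h) \<in> W_curves K p \<mu>0 \<mu>1"
  shows "(D_dist K \<pi> p a b \<mu>0 \<mu>1)\<^sup>2 \<le> W_cost K \<pi> a b \<mu> \<psi> h"
proof (cases "W_cost K \<pi> a b \<mu> \<psi> h < \<infinity>")
  case True
  note sq = W_cost_finite(1)[OF W True]
  have cont: "continuous_on {0..1} (\<lambda>t. total \<pi> (\<mu> t))"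
    by (rule bounded_linear.continuous_on[OF bounded_linear_total abs_cont_curve_imp_continuous_on[OF W_curvesD(2)[OF W]]])
  obtain r where r: "r \<in> {0..1}" "\<And>t. t \<in> {0..1} \<Longrightarrow> total \<pi> (\<mu> t) \<le> total \<pi> (\<mu> r)"
    using continuous_attains_sup[OF _ _ cont] by auto
  define L where "L = 2 * total \<pi> (\<mu> r) - total \<pi> \<mu>0 - total \<pi> \<mu>1"
  have "L\<^sup>2 \<le> (\<integral>t. (h t)\<^sup>2 \<partial>unit_time)"
    using max_increments_sq_le[OF W_curvesD(6)[OF W] sq total_increment_le[OF W sq] r]
    by (simp add: L_def W_curvesD(3,4)[OF W])
  then have "ennreal (a\<^sup>2 * L\<^sup>2) \<le> ennreal (a\<^sup>2) * (\<integral>\<^sup>+ t. ennreal ((h t)\<^sup>2) \<partial>unit_time)"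
    by (subst nn_integral_eq_integral[OF sq]) (auto simp flip: ennreal_mult intro!: ennreal_leI mult_left_mono)
  moreover have "(D_dist K \<pi> p a b \<mu>0 \<mu>1)\<^sup>2 \<le> ennreal (a\<^sup>2 * L\<^sup>2)
      + ennreal (b\<^sup>2) * (\<integral>\<^sup>+ t. ennreal (energy K \<pi> (\<psi> t) (\<mu> t)) \<partial>unit_time)"
    using D_dist_sq_le_shifted[OF W r(2), of 0] p_pos by (simp add: L_def pos_meas_def less_imp_le)
  ultimately show ?thesis unfolding W_cost_energy by (auto intro: order_trans add_right_mono)
qed (auto simp: less_top[symmetric])

lemma transport_part_eq_imp:
  assumes "transport_part \<mu>0 = transport_part \<mu>1" shows "\<mu>0 - \<mu>1 \<in> span {p}"
proof -
  have "\<mu>0 - \<mu>1 = (total \<pi> \<mu>0 - total \<pi> \<mu>1) *\<^sub>R p"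
    using assms by (simp add: transport_part_def algebra_simps)
  then show ?thesis by (simp add: span_base span_scale)
qed

text \<open>The hypotheses of \<open>uniform_shift_gain\<close> are met with constants that do not depend on the curve: the bound on
  \<open>\<integral> h\<^sup>2\<close> bounds the total mass by \<open>M0\<close>, hence the densities by \<open>M\<close>, which gives both the constant \<open>B\<close>
  relating velocity and energy and the constant \<open>\<rho>\<close> with \<open>\<rho> \<mu> \<le> p\<close>.  The distance \<open>\<zeta>\<close> is the
  displacement of a coordinate in which the transport parts of the end points differ.\<close>

lemma D_dist_uniform_gap:
  assumes ns: "\<mu>0 - \<mu>1 \<notin> span {p}" and "0 < \<Lambda>" and "\<mu>0 \<in> meas"
  obtains \<delta> where "0 < \<delta>" and "\<And>\<mu> \<psi> h. (\<mu>, \<psi>, h) \<in> W_curves K p \<mu>0 \<mu>1 \<Longrightarrow>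
    W_cost K \<pi> a b \<mu> \<psi> h \<le> ennreal \<Lambda> \<Longrightarrow>
    (D_dist K \<pi> p a b \<mu>0 \<mu>1)\<^sup>2 + ennreal \<delta> \<le> W_cost K \<pi> a b \<mu> \<psi> h"
proof -
  have "transport_part \<mu>0 \<noteq> transport_part \<mu>1" using transport_part_eq_imp ns by blast
  then obtain x where x: "transport_part \<mu>0 $ x \<noteq> transport_part \<mu>1 $ x" by (auto simp: vec_eq_iff)
  define \<zeta> where "\<zeta> = \<bar>transport_part \<mu>1 $ x - transport_part \<mu>0 $ x\<bar>"
  have "0 < \<zeta>" using x by (simp add: \<zeta>_def)
  define c where "c = Min (range \<pi>)"
  have c: "0 < c" "c \<le> \<pi> y" for y using \<pi>_pos by (auto simp: c_def)
  define q where "q = Min (range (\<lambda>x. p $ x))"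
  have q: "0 < q" "q \<le> p $ y" for y using p_pos by (auto simp: q_def pos_meas_def)
  define M0 where "M0 = total \<pi> \<mu>0 + 1 + \<Lambda> / a\<^sup>2"
  have "0 \<le> total \<pi> \<mu>0"
    using \<open>\<mu>0 \<in> meas\<close> by (auto simp: total_def meas_def \<pi>_nonneg intro!: sum_nonneg)
  moreover have "0 < \<Lambda> / a\<^sup>2" using \<open>0 < \<Lambda>\<close> a_pos by simp
  ultimately have "0 < M0" unfolding M0_def by linarith
  define M where "M = M0 / c"
  have "0 < M" using \<open>0 < M0\<close> c by (simp add: M_def)
  define B where "B = 2 * M / \<pi> x"
  have "0 < B" using \<open>0 < M\<close> \<pi>_pos by (simp add: B_def)
  define \<rho> where "\<rho> = q / M"
  have "0 < \<rho>" using \<open>0 < M\<close> q by (simp add: \<rho>_def)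
  show ?thesis
  proof (rule uniform_shift_gain[OF a_pos b_pos \<open>0 < \<Lambda>\<close> \<open>0 < B\<close> \<open>0 < \<zeta>\<close> \<open>0 < \<rho>\<close>],
      rule that)
    fix \<delta>
    assume "0 < \<delta>" and gap: "\<And>h e f m.
      h \<in> borel_measurable unit_time \<Longrightarrow> integrable unit_time (\<lambda>t. (h t)\<^sup>2) \<Longrightarrow>
      integrable unit_time e \<Longrightarrow> (\<And>t. 0 \<le> e t) \<Longrightarrow>
      f \<in> borel_measurable unit_time \<Longrightarrow> (\<And>t. t \<in> {0..1} \<Longrightarrow> (f t)\<^sup>2 \<le> B * e t) \<Longrightarrow>
      continuous_on {0..1} m \<Longrightarrow>
      (\<And>u v. 0 \<le> u \<Longrightarrow> u \<le> v \<Longrightarrow> v \<le> 1 \<Longrightarrow>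
         \<bar>m v - m u\<bar> \<le> (\<integral>t. indicator {u<..<v} t * \<bar>h t\<bar> \<partial>unit_time)) \<Longrightarrow>
      \<zeta> \<le> (\<integral>t. \<bar>f t\<bar> \<partial>unit_time) \<Longrightarrow>
      a\<^sup>2 * (\<integral>t. (h t)\<^sup>2 \<partial>unit_time) + b\<^sup>2 * (\<integral>t. e t \<partial>unit_time) \<le> \<Lambda> \<Longrightarrow>
      \<exists>C. (\<forall>t\<in>{0..1}. m t \<le> C) \<and>
        a\<^sup>2 * (2 * C - m 0 - m 1)\<^sup>2 + b\<^sup>2 * (\<integral>t. e t / (1 + \<rho> * (C - m t)) \<partial>unit_time) + \<delta>
        \<le> a\<^sup>2 * (\<integral>t. (h t)\<^sup>2 \<partial>unit_time) + b\<^sup>2 * (\<integral>t. e t \<partial>unit_time)"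
    show "0 < \<delta>" by fact
    fix \<mu> \<psi> h
    assume W: "(\<mu>, \<psi>, h) \<in> W_curves K p \<mu>0 \<mu>1" and cost: "W_cost K \<pi> a b \<mu> \<psi> h \<le> ennreal \<Lambda>"
    have fin: "W_cost K \<pi> a b \<mu> \<psi> h < \<infinity>" using cost by (rule order.strict_trans1) simp
    note sq = W_cost_finite(1)[OF W fin] and e = W_cost_finite(2)[OF W fin]
      and cost_eq = W_cost_finite(3)[OF W fin]
    define en where "en t = energy K \<pi> (\<psi> t) (\<mu> t)" for t
    define m where "m t = total \<pi> (\<mu> t)" for t
    define f where "f t = - (divg K (momentum (\<psi> t) (\<mu> t)) $ x)" for t
    define X where "X = (\<integral>t. (h t)\<^sup>2 \<partial>unit_time)"
    define E where "E = (\<integral>t. en t \<partial>unit_time)"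
    note e = e[folded en_def] and cost_eq = cost_eq[folded en_def, folded X_def E_def]
    note incr = total_increment_le[OF W sq, folded m_def]
    have en0: "0 \<le> en t" for t by (simp add: en_def energy_nonneg)
    have XE: "0 \<le> X" "0 \<le> E" using en0 by (auto simp: X_def E_def)
    have bound: "a\<^sup>2 * X + b\<^sup>2 * E \<le> \<Lambda>" using cost \<open>0 < \<Lambda>\<close> unfolding cost_eq by simp
    have "a\<^sup>2 * X \<le> \<Lambda>" using bound XE mult_nonneg_nonneg[of "b\<^sup>2" E] by (smt (verit) zero_le_power2)
    then have X: "X \<le> \<Lambda> / a\<^sup>2" using a_pos by (simp add: field_simps)
    have m_le: "m t \<le> M0" if t: "t \<in> {0..1}" for t
    proof -
      have "(\<bar>m t - m 0\<bar> + \<bar>m t - m 1\<bar>)\<^sup>2 \<le> (1 - (t - t)) * X"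
        unfolding X_def using t by (intro outer_increments_le[OF W_curvesD(6)[OF W] sq incr]) auto
      moreover have "(m t - m 0)\<^sup>2 \<le> (\<bar>m t - m 0\<bar> + \<bar>m t - m 1\<bar>)\<^sup>2"
        by (subst power2_abs[symmetric], rule power_mono) auto
      moreover have "m t - m 0 \<le> 1 + (m t - m 0)\<^sup>2"
        using abs_le_one_plus_square[of "m t - m 0"] by linarith
      ultimately show ?thesis using X by (simp add: M0_def m_def W_curvesD(3)[OF W])
    qed
    have \<mu>_le: "\<mu> t $ y \<le> M" if t: "t \<in> {0..1}" for t y
    proof -
      have nn: "0 \<le> \<mu> t $ z" for z using W_curvesD(1)[OF W t] by (simp add: meas_def)
      have "\<mu> t $ y * c \<le> \<mu> t $ y * \<pi> y" using c nn by (intro mult_left_mono) auto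
      also have "\<dots> \<le> m t" unfolding m_def total_def
        by (rule member_le_sum) (auto simp: nn \<pi>_nonneg)
      also have "\<dots> \<le> M0" by (rule m_le[OF t])
      finally show ?thesis using c by (simp add: M_def field_simps)
    qed
    have \<rho>_le: "\<rho> * \<mu> t $ y \<le> p $ y" if t: "t \<in> {0..1}" for t y
    proof -
      have "\<rho> * \<mu> t $ y \<le> \<rho> * M" using \<mu>_le[OF t] \<open>0 < \<rho>\<close> by (intro mult_left_mono) auto
      then show ?thesis using q(2)[of y] \<open>0 < M\<close> by (simp add: \<rho>_def)
    qed
    have fm: "f \<in> borel_measurable unit_time"
      using W_curves_measurable(3)[OF W, of x] unfolding f_def by measurable
    have f_sq: "(f t)\<^sup>2 \<le> B * en t" if t: "t \<in> {0..1}" for t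
      using divg_momentum_sq_le[OF W_curvesD(1)[OF W t] \<mu>_le[OF t]] by (simp add: f_def B_def en_def)
    have "integrable unit_time (\<lambda>t. (f t)\<^sup>2)"
      by (rule Bochner_Integration.integrable_bound[of _ "\<lambda>t. B * en t"])
        (use e fm f_sq en0 \<open>0 < B\<close> in \<open>auto simp: abs_of_nonneg\<close>)
    from finite_measure_Cauchy_Schwarz(1)[OF finite_measure_unit_time sets.empty_sets fm this]
    have f_int: "integrable unit_time (\<lambda>t. \<bar>f t\<bar>)" .
    have bl: "bounded_linear (\<lambda>\<mu>. transport_part \<mu> $ x)"
      by (rule bounded_linear_compose[OF bounded_linear_vec_nth bounded_linear_transport_part])
    have "\<bar>transport_part (\<mu> 1) $ x - transport_part (\<mu> 0) $ x\<bar>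
        \<le> (\<integral>t. indicator {0<..<1} t * \<bar>f t\<bar> \<partial>unit_time)"
    proof (rule abs_cont_increment_le)
      show "abs_cont_curve 0 1 (\<lambda>t. transport_part (\<mu> t) $ x)"
        using abs_cont_curve_bounded_linear[OF W_curvesD(2)[OF W] bl, of 0] by simp
      show "AE t in unit_time. ((\<lambda>t. transport_part (\<mu> t) $ x) has_vector_derivative f t) (at t within {0..1})"
        using W_curves_derivatives(2)[OF W]
        by eventually_elim (auto dest: bounded_linear.has_vector_derivative[OF bounded_linear_vec_nth, where ?i1 = x] simp: f_def)
      show "integrable unit_time f" using f_int integrable_abs_iff[OF fm] by simp
    qed auto
    also have "\<dots> \<le> (\<integral>t. \<bar>f t\<bar> \<partial>unit_time)"
      using f_int by (intro integral_mono') (auto simp: indicator_def)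
    finally have \<zeta>_le: "\<zeta> \<le> (\<integral>t. \<bar>f t\<bar> \<partial>unit_time)" by (simp add: \<zeta>_def W_curvesD(3,4)[OF W])
    have cont: "continuous_on {0..1} m" unfolding m_def
      by (rule bounded_linear.continuous_on[OF bounded_linear_total abs_cont_curve_imp_continuous_on[OF W_curvesD(2)[OF W]]])
    obtain C where C: "\<And>t. t \<in> {0..1} \<Longrightarrow> m t \<le> C"
      and gain: "a\<^sup>2 * (2 * C - m 0 - m 1)\<^sup>2 + b\<^sup>2 * (\<integral>t. en t / (1 + \<rho> * (C - m t)) \<partial>unit_time) + \<delta>
        \<le> a\<^sup>2 * X + b\<^sup>2 * E"
      using gap[OF W_curvesD(6)[OF W] sq e en0 fm f_sq cont incr \<zeta>_le] bound unfolding X_def E_def by blast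
    define I where "I = (\<integral>t. en t / (1 + \<rho> * (C - m t)) \<partial>unit_time)"
    have mm: "m \<in> borel_measurable unit_time"
      using cont by (intro continuous_imp_measurable_on_sets_lebesgue) auto
    note [measurable] = mm borel_measurable_integrable[OF e]
    have den: "1 \<le> 1 + \<rho> * (C - m t)" if "t \<in> {0..1}" for t using C[OF that] \<open>0 < \<rho>\<close> by simp
    have frac0: "0 \<le> en t / (1 + \<rho> * (C - m t))" if "t \<in> {0..1}" for t
      using den[OF that] en0[of t] by simp
    have frac_le: "en t / (1 + \<rho> * (C - m t)) \<le> en t" if "t \<in> {0..1}" for t
      using divide_left_mono[OF den[OF that] en0[of t]] den[OF that] by simp
    have "integrable unit_time (\<lambda>t. en t / (1 + \<rho> * (C - m t)))"
    proof (rule Bochner_Integration.integrable_bound[OF e _ AE_I2])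
      fix t assume "t \<in> space unit_time"
      then have t: "t \<in> {0..1}" by simp
      show "norm (en t / (1 + \<rho> * (C - m t))) \<le> norm (en t)"
        using frac0[OF t] frac_le[OF t] en0[of t] by (simp only: real_norm_def abs_of_nonneg)
    qed measurable
    then have I: "(\<integral>\<^sup>+ t. ennreal (en t / (1 + \<rho> * (C - m t))) \<partial>unit_time) = ennreal I"
      unfolding I_def by (rule nn_integral_eq_integral) (use frac0 in auto)
    have "0 \<le> I" unfolding I_def using frac0 by (intro integral_nonneg_AE AE_I2) auto
    have "(D_dist K \<pi> p a b \<mu>0 \<mu>1)\<^sup>2 \<le> ennreal (a\<^sup>2 * (2 * C - m 0 - m 1)\<^sup>2) + ennreal (b\<^sup>2) * ennreal I"
      using D_dist_sq_le_shifted[OF W C[unfolded m_def] less_imp_le[OF \<open>0 < \<rho>\<close>] \<rho>_le]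
      unfolding I[symmetric] by (simp add: m_def en_def W_curvesD(3,4)[OF W])
    then have "(D_dist K \<pi> p a b \<mu>0 \<mu>1)\<^sup>2 + ennreal \<delta>
        \<le> ennreal (a\<^sup>2 * (2 * C - m 0 - m 1)\<^sup>2) + ennreal (b\<^sup>2) * ennreal I + ennreal \<delta>"
      by (rule add_right_mono)
    also have "\<dots> = ennreal (a\<^sup>2 * (2 * C - m 0 - m 1)\<^sup>2 + b\<^sup>2 * I + \<delta>)"
      using \<open>0 \<le> I\<close> \<open>0 < \<delta>\<close> by (simp add: ennreal_plus flip: ennreal_mult)
    also have "\<dots> \<le> W_cost K \<pi> a b \<mu> \<psi> h"
      unfolding cost_eq using gain by (intro ennreal_leI) (simp add: I_def)
    finally show "(D_dist K \<pi> p a b \<mu>0 \<mu>1)\<^sup>2 + ennreal \<delta> \<le> W_cost K \<pi> a b \<mu> \<psi> h" .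
  qed
qed

end

lemma ennreal_power2_strict_mono: "x < y \<Longrightarrow> x\<^sup>2 < (y\<^sup>2 :: ennreal)"
  by (cases x; cases y) (auto simp: ennreal_power ennreal_less_iff power_strict_mono power_less_top_ennreal)

theorem theorem3p12:
  fixes K :: "'x::finite \<Rightarrow> 'x \<Rightarrow> real" and \<pi> :: "'x \<Rightarrow> real"
    and p \<mu>0 \<mu>1 :: "real ^ 'x" and a b :: real
  assumes "markov_kernel K" and "irreducible_kernel K"
    and "invariant_probability K \<pi>" and "reversible_kernel K \<pi>"
    and "0 < a" and "0 < b"
    and "p \<in> pos_meas" and "(\<Sum>x\<in>UNIV. p $ x * \<pi> x) = 1"
    and "\<mu>0 \<in> meas" and "\<mu>1 \<in> meas"
  shows "D_dist K \<pi> p a b \<mu>0 \<mu>1 \<le> W_dist K \<pi> p a b \<mu>0 \<mu>1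
    \<and> (\<mu>0 - \<mu>1 \<notin> span {p} \<longrightarrow> D_dist K \<pi> p a b \<mu>0 \<mu>1 < W_dist K \<pi> p a b \<mu>0 \<mu>1)"
proof -
  interpret shift_transport K \<pi> p a b by unfold_locales fact+
  let ?D = "D_dist K \<pi> p a b \<mu>0 \<mu>1" and ?W = "W_dist K \<pi> p a b \<mu>0 \<mu>1"
  have W_sq: "?W\<^sup>2 = (INF (\<mu>, \<psi>, h) \<in> W_curves K p \<mu>0 \<mu>1. W_cost K \<pi> a b \<mu> \<psi> h)"
    by (simp add: W_dist_def esqrt_power2)
  have "?D\<^sup>2 \<le> ?W\<^sup>2" unfolding W_sq by (rule INF_greatest) (auto intro: D_dist_sq_le_W_cost)
  then have le: "?D \<le> ?W" using ennreal_power2_strict_mono[of ?W ?D] by (meson leD leI)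
  moreover have "?D < ?W" if ns: "\<mu>0 - \<mu>1 \<notin> span {p}"
  proof -
    have fin: "?D\<^sup>2 < \<infinity>" using D_dist_finite[OF assms(9,10)] by (simp add: power_less_top_ennreal)
    \<comment> \<open>Competitors of cost larger than \<open>\<Lambda>\<close> exceed the square of \<open>D\<close> by one anyway.\<close>
    define \<Lambda> where "\<Lambda> = enn2real (?D\<^sup>2) + 1"
    have \<Lambda>: "0 < \<Lambda>" "ennreal \<Lambda> = ?D\<^sup>2 + 1" using fin by (auto simp: \<Lambda>_def ennreal_plus add_nonneg_pos)
    obtain \<delta> where "0 < \<delta>" and gap: "\<And>\<mu> \<psi> h. (\<mu>, \<psi>, h) \<in> W_curves K p \<mu>0 \<mu>1 \<Longrightarrow>
        W_cost K \<pi> a b \<mu> \<psi> h \<le> ennreal \<Lambda> \<Longrightarrow> ?D\<^sup>2 + ennreal \<delta> \<le> W_cost K \<pi> a b \<mu> \<psi> h"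
      using D_dist_uniform_gap[OF ns \<Lambda>(1) assms(9)] by blast
    have "?D\<^sup>2 + ennreal (min \<delta> 1) \<le> ?W\<^sup>2"
      unfolding W_sq
    proof (rule INF_greatest, clarify)
      fix \<mu> \<psi> h assume W: "(\<mu>, \<psi>, h) \<in> W_curves K p \<mu>0 \<mu>1"
      show "?D\<^sup>2 + ennreal (min \<delta> 1) \<le> W_cost K \<pi> a b \<mu> \<psi> h"
      proof (cases "W_cost K \<pi> a b \<mu> \<psi> h \<le> ennreal \<Lambda>")
        case True
        have "?D\<^sup>2 + ennreal (min \<delta> 1) \<le> ?D\<^sup>2 + ennreal \<delta>" by (intro add_left_mono ennreal_leI) simp
        also note gap[OF W True]
        finally show ?thesis .
      next
        case False
        have "?D\<^sup>2 + ennreal (min \<delta> 1) \<le> ?D\<^sup>2 + ennreal 1" by (intro add_left_mono ennreal_leI) simp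
        also have "\<dots> \<le> W_cost K \<pi> a b \<mu> \<psi> h" using False \<Lambda>(2) by simp
        finally show ?thesis .
      qed
    qed
    moreover have "?D\<^sup>2 < ?D\<^sup>2 + ennreal (min \<delta> 1)"
    proof -
      obtain d where "?D\<^sup>2 = ennreal d" "0 \<le> d" using fin by (cases "?D\<^sup>2") auto
      then show ?thesis using \<open>0 < \<delta>\<close> by (simp add: ennreal_less_iff flip: ennreal_plus)
    qed
    ultimately have "?D\<^sup>2 < ?W\<^sup>2" by (rule less_le_trans[rotated])
    then have "?D \<noteq> ?W" by auto
    with le show ?thesis by simp
  qed
  ultimately show ?thesis by blast
qed

end
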